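(* Let $H$ be a complex Hilbert space with $\dim H\geq 2$ and let $\phi:E(H)\to E(H)$ be a bijective map which preserves the order and zero product in both directions, i.e., for all $A,B\in E(H)$, $A\leq B \Longleftrightarrow \phi(A)\leq\phi(B)$ and $AB=0\Longleftrightarrow \phi(A)\phi(B)=0$. Then there exist an either unitary or antiunitary operator $U$ on $H$ and a real number $p<1$ such that, with the function $f_p(x)=\frac{x}{xp+(1-p)}$ $(x\in[0,1])$, we have \[ \phi(A)=U f_p(A) U^* \qquad (A\in E(H)). \]
   Context: $E(H)$ denotes the set of all (Hilbert space) effects on $H$, i.e., all positive bounded linear operators $A$ on $H$ with $0\leq A\leq I$. The order $\leq$ is the usual order among self-adjoint bounded linear operators. $f_p(A)$ denotes the image of the function $f_p$ under the continuous functional calculus belonging to the operator $A$. *)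

theory Defs
  imports "HOL-Analysis.Analysis" "HOL-Computational_Algebra.Polynomial"
begin

text \<open>
  The complex inner product is linear in its first argument. Its real part is the real inner
  product of the underlying \<^class>\<open>real_inner\<close> space, so positive definiteness and
  the compatibility with norm, metric and topology are inherited from there.
\<close>

class complex_inner_space = real_inner +
  fixes scaleC :: "complex \<Rightarrow> 'a \<Rightarrow> 'a" (infixr \<open>*\<^sub>C\<close> 75)
    and cinner :: "'a \<Rightarrow> 'a \<Rightarrow> complex"
  assumes scaleC_add_right: "a *\<^sub>C (x + y) = a *\<^sub>C x + a *\<^sub>C y"
    and scaleC_add_left: "(a + b) *\<^sub>C x = a *\<^sub>C x + b *\<^sub>C x"
    and scaleC_scaleC: "a *\<^sub>C b *\<^sub>C x = (a * b) *\<^sub>C x"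
    and scaleC_of_real: "complex_of_real r *\<^sub>C x = r *\<^sub>R x"
    and cinner_add_left: "cinner (x + y) z = cinner x z + cinner y z"
    and cinner_scaleC_left: "cinner (a *\<^sub>C x) y = a * cinner x y"
    and cinner_commute: "cinner x y = cnj (cinner y x)"
    and inner_eq_Re_cinner: "inner x y = Re (cinner x y)"

class complex_hilbert_space = complex_inner_space + complete_space

lemma scaleC_one: "1 *\<^sub>C x = (x :: 'a :: complex_inner_space)"
  using scaleC_of_real[of 1 x] by simp

global_interpretation cspace:
  vector_space "scaleC :: complex \<Rightarrow> 'a \<Rightarrow> 'a :: complex_inner_space"
  by unfold_locales
    (simp_all add: scaleC_add_right scaleC_add_left scaleC_scaleC scaleC_one)

text \<open>
  Elements of \<^typ>\<open>'a \<Rightarrow>\<^sub>L 'a\<close> are bounded and real-linear. This type therefore contains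
  the bounded complex-linear operators as well as the bounded conjugate-linear ones.
\<close>

definition clinear_op :: "('a::complex_hilbert_space \<Rightarrow>\<^sub>L 'a) \<Rightarrow> bool" where
  "clinear_op A \<longleftrightarrow> (\<forall>c x. blinfun_apply A (c *\<^sub>C x) = c *\<^sub>C blinfun_apply A x)"

definition antilinear_op :: "('a::complex_hilbert_space \<Rightarrow>\<^sub>L 'a) \<Rightarrow> bool" where
  "antilinear_op A \<longleftrightarrow> (\<forall>c x. blinfun_apply A (c *\<^sub>C x) = cnj c *\<^sub>C blinfun_apply A x)"

text \<open>
  The adjoint of a conjugate-linear operator satisfies the conjugated identity. The only
  operator that is both linear and conjugate-linear is 0, whose adjoint is 0 in either sense.
\<close>

definition is_adjoint ::
    "('a::complex_hilbert_space \<Rightarrow>\<^sub>L 'a) \<Rightarrow> ('a \<Rightarrow>\<^sub>L 'a) \<Rightarrow> bool" where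
  "is_adjoint A B \<longleftrightarrow>
     clinear_op A \<and>
       (\<forall>x y. cinner (blinfun_apply A x) y = cinner x (blinfun_apply B y)) \<or>
     antilinear_op A \<and>
       (\<forall>x y. cinner (blinfun_apply A x) y = cnj (cinner x (blinfun_apply B y)))"

definition adj_op :: "('a::complex_hilbert_space \<Rightarrow>\<^sub>L 'a) \<Rightarrow> ('a \<Rightarrow>\<^sub>L 'a)" where
  "adj_op A = (THE B. is_adjoint A B)"

definition unitary_op :: "('a::complex_hilbert_space \<Rightarrow>\<^sub>L 'a) \<Rightarrow> bool" where
  "unitary_op U \<longleftrightarrow> clinear_op U \<and>
     adj_op U o\<^sub>L U = id_blinfun \<and> U o\<^sub>L adj_op U = id_blinfun"

definition antiunitary_op :: "('a::complex_hilbert_space \<Rightarrow>\<^sub>L 'a) \<Rightarrow> bool" where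
  "antiunitary_op U \<longleftrightarrow> antilinear_op U \<and>
     adj_op U o\<^sub>L U = id_blinfun \<and> U o\<^sub>L adj_op U = id_blinfun"

text \<open>
  On a complex Hilbert space, a bounded operator with a real-valued quadratic form is
  self-adjoint, so self-adjointness is not a separate conjunct.
\<close>

definition positive_op :: "('a::complex_hilbert_space \<Rightarrow>\<^sub>L 'a) \<Rightarrow> bool" where
  "positive_op A \<longleftrightarrow> clinear_op A \<and> (\<forall>x. cinner (blinfun_apply A x) x \<in> \<real>\<^sub>\<ge>\<^sub>0)"

definition op_le :: "('a::complex_hilbert_space \<Rightarrow>\<^sub>L 'a) \<Rightarrow> ('a \<Rightarrow>\<^sub>L 'a) \<Rightarrow> bool"
    (infix \<open>\<preceq>\<close> 50) where
  "A \<preceq> B \<longleftrightarrow> positive_op (B - A)"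

definition effects :: "('a::complex_hilbert_space \<Rightarrow>\<^sub>L 'a) set" where
  "effects = {A. 0 \<preceq> A \<and> A \<preceq> id_blinfun}"

definition op_spectrum :: "('a::complex_hilbert_space \<Rightarrow>\<^sub>L 'a) \<Rightarrow> complex set" where
  "op_spectrum A = {c. \<not> (\<exists>B. clinear_op B \<and>
     (\<forall>x. blinfun_apply B (blinfun_apply A x - c *\<^sub>C x) = x) \<and>
     (\<forall>x. blinfun_apply A (blinfun_apply B x) - c *\<^sub>C blinfun_apply B x = x))}"

definition poly_op :: "real poly \<Rightarrow> ('a::complex_hilbert_space \<Rightarrow>\<^sub>L 'a) \<Rightarrow> ('a \<Rightarrow>\<^sub>L 'a)" where
  "poly_op q A = (\<Sum>i\<le>degree q. coeff q i *\<^sub>R (((o\<^sub>L) A ^^ i) id_blinfun))"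

text \<open>
  Continuous functional calculus of a self-adjoint operator \<open>A\<close>, for real-valued functions
  continuous on the spectrum: \<open>f(A)\<close> is the operator norm limit of \<open>q\<^sub>n(A)\<close> for real
  polynomials \<open>q\<^sub>n\<close> that converge to \<open>f\<close> uniformly on the spectrum. The value is
  unspecified for other arguments.
\<close>

definition cfc :: "(real \<Rightarrow> real) \<Rightarrow> ('a::complex_hilbert_space \<Rightarrow>\<^sub>L 'a) \<Rightarrow> ('a \<Rightarrow>\<^sub>L 'a)" where
  "cfc f A = (THE T. \<forall>q :: nat \<Rightarrow> real poly.
     uniform_limit {x. complex_of_real x \<in> op_spectrum A} (\<lambda>n. poly (q n)) f sequentially
       \<longrightarrow> (\<lambda>n. poly_op (q n) A) \<longlonglongrightarrow> T)"

definition f_fun :: "real \<Rightarrow> real \<Rightarrow> real" where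
  "f_fun p x = x / (x * p + (1 - p))"

end

theory Submission
  imports Defs "HOL-Computational_Algebra.Fundamental_Theorem_Algebra"
begin

text \<open>
  A rank one projection \<open>P\<close> and its multiples are visible in the order: they are the effects whose
  lower set is a chain. Hence \<open>\<phi>\<close> maps rank one projections to rank one projections, say
  \<open>P\<close> to \<open>P'\<close>, and it maps \<open>t P\<close> to a multiple of \<open>P'\<close> (\<open>image_scaled_rank_one\<close>). In the
  coordinate \<open>u = 1 / t - 1\<close>, which runs through \<open>[0, \<infinity>)\<close>, this gives an increasing
  bijection \<open>F\<^sub>P\<close> of \<open>[0, \<infinity>)\<close>, and \<open>f\<^sub>p\<close> becomes multiplication by \<open>1 - p\<close>. One has to show
  that all \<open>F\<^sub>P\<close> are multiplication by one common constant.

  Zero products determine complements, so \<open>\<phi> (1 - P) = 1 - P'\<close>, and the effects above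
  \<open>1 - P\<close> are the \<open>1 - s P\<close>. The largest multiple of \<open>Q\<close> below an invertible effect \<open>A\<close> is
  \<open>1 / \<langle>A\<^sup>-\<^sup>1 y, y\<rangle>\<close>, where the unit vector \<open>y\<close> spans the range of \<open>Q\<close> (\<open>strength_iff\<close>). For
  \<open>A = 1 - s P\<close> this number depends only on \<open>s\<close> and on the transition probability
  \<open>c = tr (P Q)\<close>. Since \<open>\<phi>\<close> preserves these relations,
  \<open>F\<^sub>Q (c u) = c' F\<^sub>P u\<close> with \<open>c' = tr (P' Q')\<close> (\<open>ray_scale_transition\<close>).

  Orthogonality is preserved, hence so is the span of two orthogonal projections, in which
  transition probabilities add up to \<open>1\<close>. For \<open>c = 1/2\<close> this forces \<open>c' = 1/2\<close>, thus
  \<open>F\<^sub>P (u / 4) = F\<^sub>P u / 4\<close>; monotonicity then forces \<open>c' = c\<close> in general, and the functional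
  equation makes \<open>F\<^sub>P u = k u\<close> with \<open>k > 0\<close> independent of \<open>P\<close> (\<open>transition_rigidity\<close>). This
  works in every dimension from \<open>2\<close> on. Wigner's theorem (\<open>Wigner\<close>) provides the unitary or
  antiunitary \<open>U\<close> with \<open>P' = U P U\<^sup>*\<close>, and \<open>\<phi> (t P) = f\<^sub>p(t) U P U\<^sup>*\<close> for \<open>p = 1 - k\<close>.

  Finally an effect is determined by the rank one effects below it
  (\<open>effects_le_rank_one\<close>), and \<open>t P \<le> A\<close> is equivalent to \<open>f\<^sub>p(t) P \<le> f\<^sub>p(A)\<close>
  (\<open>f_solution_rank_one_le\<close>, applied to \<open>f\<^sub>p\<close> and to its inverse, which is of the same kind).
  All that is needed of the functional calculus is the equation
  \<open>f\<^sub>p(A) (p A + (1 - p)) = A\<close>, which follows from the bound of \<open>\<parallel>q(A)\<parallel>\<close> by the values of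
  the polynomial \<open>q\<close> on the spectrum (\<open>norm_poly_op_le\<close>).
\<close>

section \<open>Complex inner product spaces\<close>

lemma cinner_add_right: "cinner x (y + z) = cinner x y + cinner x z"
  for x :: "'a::complex_inner_space"
  by (metis cinner_add_left cinner_commute complex_cnj_add)

lemma cinner_scaleC_right: "cinner x (a *\<^sub>C y) = cnj a * cinner x y"
  for x :: "'a::complex_inner_space"
  by (metis cinner_scaleC_left cinner_commute complex_cnj_mult)

lemma cinner_scaleR_left [simp]: "cinner (r *\<^sub>R x) y = complex_of_real r * cinner x y"
  for x :: "'a::complex_inner_space"
  by (metis cinner_scaleC_left scaleC_of_real)

lemma cinner_scaleR_right [simp]: "cinner x (r *\<^sub>R y) = complex_of_real r * cinner x y"
  for x :: "'a::complex_inner_space"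
  by (metis cinner_scaleC_right complex_cnj_complex_of_real scaleC_of_real)

lemma cinner_zero_left [simp]: "cinner 0 x = 0"
  for x :: "'a::complex_inner_space"
  by (metis add_cancel_right_right cinner_add_left)

lemma cinner_zero_right [simp]: "cinner x 0 = 0"
  for x :: "'a::complex_inner_space"
  by (metis add_cancel_right_right cinner_add_right)

lemma cinner_minus_left: "cinner (- x) y = - cinner x y"
  for x :: "'a::complex_inner_space"
  by (metis add.right_inverse cinner_add_left cinner_zero_left minus_unique)

lemma cinner_minus_right: "cinner x (- y) = - cinner x y"
  for x :: "'a::complex_inner_space"
  by (metis add.right_inverse cinner_add_right cinner_zero_right minus_unique)

lemma cinner_diff_left: "cinner (x - y) z = cinner x z - cinner y z"
  for x :: "'a::complex_inner_space"
  by (metis cinner_add_left cinner_minus_left diff_conv_add_uminus)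

lemma cinner_diff_right: "cinner x (y - z) = cinner x y - cinner x z"
  for x :: "'a::complex_inner_space"
  by (metis cinner_add_right cinner_minus_right diff_conv_add_uminus)

lemmas cinner_algebra =
  cinner_add_left cinner_add_right cinner_diff_left cinner_diff_right cinner_minus_left
  cinner_minus_right cinner_scaleC_left cinner_scaleC_right

lemma cinner_self: "cinner x x = complex_of_real ((norm x)\<^sup>2)"
  for x :: "'a::complex_inner_space"
proof -
  have "Im (cinner x x) = 0"
    using arg_cong[OF cinner_commute[of x x], of Im] by simp
  moreover have "Re (cinner x x) = (norm x)\<^sup>2"
    by (metis inner_eq_Re_cinner power2_norm_eq_inner)
  ultimately show ?thesis
    by (simp add: complex_eq_iff)
qed

lemma mult_cnj: "c * cnj c = (complex_of_real (cmod c))\<^sup>2"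
  by (metis complex_norm_square of_real_power)

lemma norm_scaleC [simp]: "norm (c *\<^sub>C x) = cmod c * norm x"
  for x :: "'a::complex_inner_space"
proof -
  have "complex_of_real ((norm (c *\<^sub>C x))\<^sup>2) = (c * cnj c) * cinner x x"
    unfolding cinner_self[symmetric] by (simp add: cinner_algebra)
  also have "\<dots> = complex_of_real ((cmod c * norm x)\<^sup>2)"
    by (simp add: mult_cnj cinner_self power_mult_distrib)
  finally have "(norm (c *\<^sub>C x))\<^sup>2 = (cmod c * norm x)\<^sup>2"
    using of_real_eq_iff by blast
  then show ?thesis
    by (simp add: power2_eq_iff_nonneg)
qed

lemma cinner_eq_0_commute: "cinner x y = 0 \<longleftrightarrow> cinner y x = 0"
  for x :: "'a::complex_inner_space"
  by (metis cinner_commute complex_cnj_zero)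

lemma cmod_cinner_commute: "cmod (cinner x y) = cmod (cinner y x)"
  for x :: "'a::complex_inner_space"
  by (metis cinner_commute complex_mod_cnj)

text \<open>The component of \<open>y\<close> orthogonal to a unit vector \<open>x\<close>.\<close>

lemma cinner_residual:
  fixes x y :: "'a::complex_inner_space"
  assumes "norm x = 1"
  shows "cinner (y - cinner y x *\<^sub>C x) x = 0"
    and "(norm (y - cinner y x *\<^sub>C x))\<^sup>2 = (norm y)\<^sup>2 - (cmod (cinner y x))\<^sup>2"
proof -
  show 1: "cinner (y - cinner y x *\<^sub>C x) x = 0"
    using assms by (simp add: cinner_algebra cinner_self)
  have "complex_of_real ((norm (y - cinner y x *\<^sub>C x))\<^sup>2) = cinner (y - cinner y x *\<^sub>C x) y"
    unfolding cinner_self[symmetric] cinner_diff_right[of _ y] cinner_scaleC_right 1 by simp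
  also have "\<dots> = complex_of_real ((norm y)\<^sup>2) - cinner y x * cnj (cinner y x)"
    by (simp add: cinner_algebra cinner_self cinner_commute[of x y])
  also have "\<dots> = complex_of_real ((norm y)\<^sup>2 - (cmod (cinner y x))\<^sup>2)"
    by (simp add: mult_cnj)
  finally show "(norm (y - cinner y x *\<^sub>C x))\<^sup>2 = (norm y)\<^sup>2 - (cmod (cinner y x))\<^sup>2"
    using of_real_eq_iff by blast
qed

lemma norm_cinner_le: "cmod (cinner x y) \<le> norm x * norm y"
  for x :: "'a::complex_inner_space"
proof (cases "y = 0")
  case False
  define u where "u = (1 / norm y) *\<^sub>R y"
  have u: "norm u = 1" "y = norm y *\<^sub>R u"
    using False by (simp_all add: u_def)
  have "(cmod (cinner x u))\<^sup>2 \<le> (norm x)\<^sup>2"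
    using cinner_residual(2)[OF u(1), of x] by (smt (verit) zero_le_power2)
  then have *: "cmod (cinner x u) \<le> norm x"
    by (simp add: power2_le_iff_abs_le)
  have "cmod (cinner x y) = norm y * cmod (cinner x u)"
    by (subst u(2)) (simp add: norm_mult)
  also have "\<dots> \<le> norm y * norm x"
    using * by (simp add: mult_left_mono)
  finally show ?thesis by (simp add: mult.commute)
qed simp

lemma norm_cinner_eq_unit:
  fixes x y :: "'a::complex_inner_space"
  assumes "norm x = 1" "cmod (cinner y x) = norm y"
  shows "y = cinner y x *\<^sub>C x"
  using cinner_residual(2)[OF assms(1), of y] assms(2) by simp

lemma bounded_linear_cinner_left: "bounded_linear (\<lambda>z. cinner z x)"
  for x :: "'a::complex_inner_space"
  by (rule bounded_linear_intro[of _ "norm x"])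
    (simp_all add: cinner_add_left scaleR_conv_of_real norm_cinner_le)

lemma scaleC_scaleR_commute: "c *\<^sub>C (r *\<^sub>R x) = r *\<^sub>R (c *\<^sub>C x)"
  for x :: "'a::complex_inner_space"
  by (simp only: scaleC_of_real[symmetric] scaleC_scaleC mult.commute)

lemma bounded_linear_scaleC_left: "bounded_linear (\<lambda>c. c *\<^sub>C x)"
  for x :: "'a::complex_inner_space"
proof (rule bounded_linear_intro[of _ "norm x"])
  fix r and c :: complex
  show "(r *\<^sub>R c) *\<^sub>C x = r *\<^sub>R (c *\<^sub>C x)"
    by (simp only: scaleR_conv_of_real scaleC_scaleC[symmetric] scaleC_of_real)
qed (simp_all add: scaleC_add_left)

section \<open>Self-adjoint operators and effects\<close>

definition selfadj_op :: "('a::complex_hilbert_space \<Rightarrow>\<^sub>L 'a) \<Rightarrow> bool" where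
  "selfadj_op A \<longleftrightarrow> clinear_op A \<and> (\<forall>x y. cinner (A x) y = cinner x (A y))"

lemma clinear_opD: "clinear_op A \<Longrightarrow> A (c *\<^sub>C x) = c *\<^sub>C A x"
  by (simp add: clinear_op_def)

lemma selfadj_op_clinear: "selfadj_op A \<Longrightarrow> clinear_op A"
  by (simp add: selfadj_op_def)

lemma selfadj_op_cinner: "selfadj_op A \<Longrightarrow> cinner (A x) y = cinner x (A y)"
  by (simp add: selfadj_op_def)

lemma selfadj_op_inner: "selfadj_op A \<Longrightarrow> inner (A x) y = inner x (A y)"
  by (simp add: selfadj_op_cinner inner_eq_Re_cinner)

lemma selfadj_op_cinner_self: "selfadj_op A \<Longrightarrow> cinner (A x) x = complex_of_real (inner (A x) x)"
  by (metis Reals_cnj_iff cinner_commute inner_eq_Re_cinner of_real_Re selfadj_op_cinner)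

lemma clinear_op_zero [simp]: "clinear_op 0"
  and clinear_op_id [simp]: "clinear_op id_blinfun"
  and clinear_op_add: "clinear_op A \<Longrightarrow> clinear_op B \<Longrightarrow> clinear_op (A + B)"
  and clinear_op_diff: "clinear_op A \<Longrightarrow> clinear_op B \<Longrightarrow> clinear_op (A - B)"
  and clinear_op_scaleR: "clinear_op A \<Longrightarrow> clinear_op (r *\<^sub>R A)"
  and clinear_op_compose: "clinear_op A \<Longrightarrow> clinear_op B \<Longrightarrow> clinear_op (A o\<^sub>L B)"
  by (simp_all add: clinear_op_def blinfun.bilinear_simps scaleC_add_right
      cspace.scale_right_diff_distrib scaleC_scaleR_commute)

lemma selfadj_op_zero [simp]: "selfadj_op 0"
  and selfadj_op_id [simp]: "selfadj_op id_blinfun"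
  and selfadj_op_add: "selfadj_op A \<Longrightarrow> selfadj_op B \<Longrightarrow> selfadj_op (A + B)"
  and selfadj_op_diff: "selfadj_op A \<Longrightarrow> selfadj_op B \<Longrightarrow> selfadj_op (A - B)"
  and selfadj_op_scaleR: "selfadj_op A \<Longrightarrow> selfadj_op (r *\<^sub>R A)"
  by (simp_all add: selfadj_op_def clinear_op_add clinear_op_diff clinear_op_scaleR
      blinfun.bilinear_simps cinner_algebra)

lemmas selfadj_op_intros =
  selfadj_op_zero selfadj_op_id selfadj_op_add selfadj_op_diff selfadj_op_scaleR

text \<open>Polarization: a real quadratic form forces the sesquilinear form to be Hermitian.\<close>

lemma positive_op_iff:
  "positive_op A \<longleftrightarrow> selfadj_op A \<and> (\<forall>x. 0 \<le> inner (A x) x)"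
proof
  assume A: "positive_op A"
  then have lin: "clinear_op A" by (simp add: positive_op_def)
  have re: "Im (cinner (A z) z) = 0" and nonneg: "0 \<le> Re (cinner (A z) z)" for z
    using A by (auto simp: positive_op_def complex_nonneg_Reals_iff)
  have "cinner (A x) y = cinner x (A y)" for x y
  proof -
    have "Im (cinner (A x) y + cinner (A y) x) = 0"
      using re[of "x + y"] re[of x] re[of y] by (simp add: blinfun.bilinear_simps cinner_algebra)
    moreover have "Im (cinner (A x) (\<i> *\<^sub>C y) + cinner (A (\<i> *\<^sub>C y)) x) = 0"
      using re[of "x + \<i> *\<^sub>C y"] re[of x] re[of "\<i> *\<^sub>C y"]
      by (simp add: blinfun.bilinear_simps cinner_add_left cinner_add_right)
    then have "Re (cinner (A x) y) = Re (cinner (A y) x)"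
      by (simp add: cinner_algebra clinear_opD[OF lin])
    ultimately have "cinner (A x) y = cnj (cinner (A y) x)"
      by (simp add: complex_eq_iff)
    then show ?thesis
      by (metis cinner_commute)
  qed
  then show "selfadj_op A \<and> (\<forall>x. 0 \<le> inner (A x) x)"
    using lin nonneg by (simp add: selfadj_op_def inner_eq_Re_cinner)
next
  assume "selfadj_op A \<and> (\<forall>x. 0 \<le> inner (A x) x)"
  then show "positive_op A"
    by (simp add: positive_op_def selfadj_op_clinear selfadj_op_cinner_self)
qed

lemma op_le_iff:
  assumes "selfadj_op A" "selfadj_op B"
  shows "A \<preceq> B \<longleftrightarrow> (\<forall>x. inner (A x) x \<le> inner (B x) x)"
  using assms
  by (simp add: op_le_def positive_op_iff selfadj_op_diff blinfun.diff_left inner_diff_left)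

lemma effects_iff:
  "A \<in> effects \<longleftrightarrow> selfadj_op A \<and> (\<forall>x. 0 \<le> inner (A x) x \<and> inner (A x) x \<le> (norm x)\<^sup>2)"
proof -
  have "selfadj_op A" if "positive_op A"
    using that by (simp add: positive_op_iff)
  then show ?thesis
    using op_le_iff[of A id_blinfun]
    by (auto simp: effects_def op_le_def positive_op_iff power2_norm_eq_inner)
qed

lemma effects_selfadj: "A \<in> effects \<Longrightarrow> selfadj_op A"
  and effects_nonneg: "A \<in> effects \<Longrightarrow> 0 \<le> inner (A x) x"
  and effects_le_norm: "A \<in> effects \<Longrightarrow> inner (A x) x \<le> (norm x)\<^sup>2"
  by (simp_all add: effects_iff)

lemma effects_le_iff:
  "A \<in> effects \<Longrightarrow> B \<in> effects \<Longrightarrow> A \<preceq> B \<longleftrightarrow> (\<forall>x. inner (A x) x \<le> inner (B x) x)"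
  by (simp add: op_le_iff effects_selfadj)

lemma zero_in_effects [simp]: "0 \<in> effects"
  by (simp add: effects_iff)

lemma compl_in_effects: "A \<in> effects \<Longrightarrow> id_blinfun - A \<in> effects"
  by (simp add: effects_iff selfadj_op_diff blinfun.diff_left inner_diff_left
      flip: power2_norm_eq_inner)

text \<open>
  With \<open>c = \<langle>A x, y\<rangle>\<close>, the form at \<open>x - t c y\<close> is a nonnegative quadratic polynomial in the real
  variable \<open>t\<close>.
\<close>

lemma positive_form_Cauchy_Schwarz:
  assumes A: "selfadj_op A" and pos: "\<And>x. 0 \<le> inner (A x) x"
  shows "(cmod (cinner (A x) y))\<^sup>2 \<le> inner (A x) x * inner (A y) y"
proof -
  define c where "c = cinner (A x) y"
  define a where "a = inner (A x) x"
  define b where "b = inner (A y) y"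
  have quad: "0 \<le> a - 2 * t * (cmod c)\<^sup>2 + t\<^sup>2 * (cmod c)\<^sup>2 * b" for t :: real
  proof -
    define s where "s = complex_of_real t * c"
    have yx: "cinner (A y) x = cnj c"
      using A by (metis c_def cinner_commute selfadj_op_cinner)
    have "cinner (A (x - s *\<^sub>C y)) (x - s *\<^sub>C y)
        = cinner (A x) x - cnj s * c - s * cnj c + s * cnj s * cinner (A y) y"
      using A by (simp add: blinfun.bilinear_simps clinear_opD selfadj_op_clinear cinner_algebra
          c_def[symmetric] yx algebra_simps)
    also have "\<dots> = complex_of_real (a - 2 * t * (cmod c)\<^sup>2 + t\<^sup>2 * (cmod c)\<^sup>2 * b)"
      proof -
      have 1: "cnj s * c = complex_of_real t * (c * cnj c)" "s * cnj c = complex_of_real t * (c * cnj c)"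
        and 2: "s * cnj s = (complex_of_real t)\<^sup>2 * (c * cnj c)"
        by (simp_all add: s_def power2_eq_square)
      show ?thesis
        unfolding 1 2 by (simp add: selfadj_op_cinner_self[OF A] a_def b_def mult_cnj)
    qed
    finally have "inner (A (x - s *\<^sub>C y)) (x - s *\<^sub>C y)
        = a - 2 * t * (cmod c)\<^sup>2 + t\<^sup>2 * (cmod c)\<^sup>2 * b"
      by (simp only: inner_eq_Re_cinner Re_complex_of_real)
    then show ?thesis
      using pos by metis
  qed
  have "b \<ge> 0" "a \<ge> 0" by (simp_all add: a_def b_def pos)
  have "(cmod c)\<^sup>2 \<le> a * b"
  proof (cases "b = 0")
    case True
    have "(cmod c)\<^sup>2 = 0"
    proof (rule ccontr)
      assume "(cmod c)\<^sup>2 \<noteq> 0"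
      then show False
        using quad[of "(a + 1) / (cmod c)\<^sup>2"] True \<open>a \<ge> 0\<close> by simp
    qed
    then show ?thesis by (simp add: True)
  next
    case False
    then show ?thesis
      using quad[of "1 / b"] \<open>b \<ge> 0\<close> by (simp add: field_simps power2_eq_square)
  qed
  then show ?thesis by (simp add: a_def b_def c_def)
qed

lemma positive_form_kernel:
  assumes A: "selfadj_op A" and pos: "\<And>x. 0 \<le> inner (A x) x" and "inner (A x) x = 0"
  shows "A x = 0"
  using positive_form_Cauchy_Schwarz[OF A pos, of x "A x"] assms(3) by (simp add: cinner_self)

lemma effects_kernel: "A \<in> effects \<Longrightarrow> inner (A x) x = 0 \<Longrightarrow> A x = 0"
  using positive_form_kernel effects_iff by blast

text \<open>The inequality \<open>A\<^sup>2 \<le> A\<close>.\<close>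

lemma effects_norm_apply: "A \<in> effects \<Longrightarrow> (norm (A x))\<^sup>2 \<le> inner (A x) x"
proof -
  assume A: "A \<in> effects"
  have "((norm (A x))\<^sup>2)\<^sup>2 \<le> inner (A x) x * inner (A (A x)) (A x)"
    using positive_form_Cauchy_Schwarz[OF effects_selfadj[OF A] effects_nonneg[OF A], of x "A x"]
    by (simp add: cinner_self norm_power)
  also have "\<dots> \<le> inner (A x) x * (norm (A x))\<^sup>2"
    by (intro mult_left_mono effects_le_norm effects_nonneg A)
  finally show ?thesis
    by (cases "A x = 0") (simp_all add: power2_eq_square)
qed

text \<open>
  Lax--Milgram: for small \<open>\<tau>\<close> the map \<open>x \<mapsto> x - \<tau> (S x - y)\<close> is a contraction, and its fixed
  point solves \<open>S x = y\<close>.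
\<close>

lemma coercive_bij:
  fixes S :: "'a::complex_hilbert_space \<Rightarrow>\<^sub>L 'a"
  assumes lin: "clinear_op S" and "\<delta> > 0" and coer: "\<And>x. \<delta> * (norm x)\<^sup>2 \<le> inner (S x) x"
  obtains G where "clinear_op G" "S o\<^sub>L G = id_blinfun" "G o\<^sub>L S = id_blinfun"
proof -
  define M where "M = max \<delta> (norm S) + 1"
  have M: "norm S \<le> M" "\<delta> < M" "M > 0"
    using \<open>\<delta> > 0\<close> by (auto simp: M_def)
  define \<tau> where "\<tau> = \<delta> / M\<^sup>2"
  define k where "k = sqrt (1 - \<delta>\<^sup>2 / M\<^sup>2)"
  have ratio: "0 < \<delta>\<^sup>2 / M\<^sup>2" "\<delta>\<^sup>2 / M\<^sup>2 < 1"
    using M \<open>\<delta> > 0\<close> by (simp_all add: power_strict_mono)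
  then have k: "0 \<le> k" "k < 1" "k\<^sup>2 = 1 - \<delta>\<^sup>2 / M\<^sup>2"
    by (simp_all add: k_def)
  have contr: "norm (x - \<tau> *\<^sub>R S x) \<le> k * norm x" for x
  proof -
    have "norm (S x) \<le> M * norm x"
      using norm_blinfun[of S x] M(1) by (meson mult_right_mono norm_ge_zero order_trans)
    then have Sx: "(norm (S x))\<^sup>2 \<le> M\<^sup>2 * (norm x)\<^sup>2"
      by (metis norm_ge_zero power_mono power_mult_distrib)
    have "(norm (x - \<tau> *\<^sub>R S x))\<^sup>2 = (norm x)\<^sup>2 - 2 * \<tau> * inner (S x) x + \<tau>\<^sup>2 * (norm (S x))\<^sup>2"
      by (simp add: power2_norm_eq_inner inner_diff_left inner_diff_right inner_commute)
        (simp add: power2_eq_square algebra_simps)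
    also have "\<dots> \<le> (norm x)\<^sup>2 - 2 * \<tau> * (\<delta> * (norm x)\<^sup>2) + \<tau>\<^sup>2 * (M\<^sup>2 * (norm x)\<^sup>2)"
      using Sx coer[of x] \<open>\<delta> > 0\<close> M
      by (intro add_mono diff_mono mult_left_mono order_refl) (auto simp: \<tau>_def)
    also have "\<dots> = (k * norm x)\<^sup>2"
      using M by (simp add: \<tau>_def k(3) power_mult_distrib) (simp add: power2_eq_square field_simps)
    finally show ?thesis
      using k by (simp add: power2_le_iff_abs_le)
  qed
  have ex1: "\<exists>!x. S x = y" for y
  proof -
    have "dist (x - \<tau> *\<^sub>R (S x - y)) (z - \<tau> *\<^sub>R (S z - y)) \<le> k * dist x z" for x z
    proof -
      have "dist (x - \<tau> *\<^sub>R (S x - y)) (z - \<tau> *\<^sub>R (S z - y)) = norm ((x - z) - \<tau> *\<^sub>R S (x - z))"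
        by (simp add: dist_norm blinfun.diff_right algebra_simps)
      then show ?thesis
        using contr[of "x - z"] by (simp add: dist_norm)
    qed
    then have "\<exists>!x. x - \<tau> *\<^sub>R (S x - y) = x"
      using k by (intro banach_fix_type[where c = k]) auto
    moreover have "\<tau> \<noteq> 0"
      using M \<open>\<delta> > 0\<close> by (simp add: \<tau>_def)
    ultimately show ?thesis by simp
  qed
  define g where "g y = (THE x. S x = y)" for y
  have Sg: "S (g y) = y" for y
    using theI'[OF ex1[of y]] by (simp add: g_def)
  have gS: "g (S x) = x" for x
    using Sg[of "S x"] ex1 by blast
  have bl: "bounded_linear g"
  proof (rule bounded_linear_intro[of _ "1 / \<delta>"])
    fix x y r
    show "g (x + y) = g x + g y"
      by (metis Sg gS blinfun.add_right)
    show "g (r *\<^sub>R x) = r *\<^sub>R g x"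
      by (metis Sg gS blinfun.scaleR_right)
    have "\<delta> * (norm (g x))\<^sup>2 \<le> norm x * norm (g x)"
      using coer[of "g x"] norm_cauchy_schwarz[of x "g x"] by (simp add: Sg)
    then have "\<delta> * norm (g x) \<le> norm x"
      by (cases "g x = 0") (auto simp: power2_eq_square)
    then show "norm (g x) \<le> norm x * (1 / \<delta>)"
      using \<open>\<delta> > 0\<close> by (simp add: field_simps)
  qed
  define G where "G = Blinfun g"
  have G: "G y = g y" for y
    by (simp add: G_def bounded_linear_Blinfun_apply bl)
  show thesis
  proof
    show "clinear_op G"
      unfolding clinear_op_def G by (metis Sg gS clinear_opD lin)
    show "S o\<^sub>L G = id_blinfun" "G o\<^sub>L S = id_blinfun"
      by (auto intro!: blinfun_eqI simp: G Sg gS)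
  qed
qed

lemma blinfun_compose_assoc: "(A o\<^sub>L B) o\<^sub>L C = A o\<^sub>L (B o\<^sub>L C)"
  and blinfun_compose_id_right [simp]: "A o\<^sub>L id_blinfun = A"
  by (simp_all add: blinfun_eqI)


section \<open>Polynomials of a self-adjoint operator\<close>

lemma poly_op_0 [simp]: "poly_op 0 A = 0"
  by (simp add: poly_op_def)

lemma poly_op_pCons: "poly_op (pCons a q) A = a *\<^sub>R id_blinfun + (A o\<^sub>L poly_op q A)"
proof (cases "q = 0")
  case False
  have "poly_op (pCons a q) A = a *\<^sub>R id_blinfun
      + (\<Sum>i\<le>degree q. coeff q i *\<^sub>R (A o\<^sub>L (((o\<^sub>L) A ^^ i) id_blinfun)))"
    using False by (simp add: poly_op_def sum.atMost_Suc_shift del: sum.atMost_Suc)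
  also have "(\<Sum>i\<le>degree q. coeff q i *\<^sub>R (A o\<^sub>L (((o\<^sub>L) A ^^ i) id_blinfun))) = A o\<^sub>L poly_op q A"
    unfolding poly_op_def by (rule blinfun_eqI) (simp add: blinfun.bilinear_simps blinfun.sum_left blinfun.sum_right)
  finally show ?thesis .
qed (simp add: poly_op_def)

lemma poly_op_smult: "poly_op (smult a q) A = a *\<^sub>R poly_op q A"
  by (induction q) (auto intro!: blinfun_eqI simp: poly_op_pCons blinfun.bilinear_simps algebra_simps)

lemma poly_op_add: "poly_op (q + r) A = poly_op q A + poly_op r A"
  by (induction q r rule: poly_induct2)
    (auto intro!: blinfun_eqI simp: poly_op_pCons blinfun.bilinear_simps algebra_simps)

lemma poly_op_diff: "poly_op (q - r) A = poly_op q A - poly_op r A"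
  using poly_op_add[of q "smult (-1) r" A] poly_op_smult[of "-1" r A] by simp

lemma poly_op_mult: "poly_op (q * r) A = poly_op q A o\<^sub>L poly_op r A"
  by (induction q) (auto intro!: blinfun_eqI
      simp: poly_op_pCons poly_op_add poly_op_smult blinfun.bilinear_simps algebra_simps)

lemma poly_op_commute: "poly_op q A (A x) = A (poly_op q A x)"
  by (induction q) (simp_all add: poly_op_pCons blinfun.bilinear_simps)

lemma selfadj_poly_op:
  assumes A: "selfadj_op A"
  shows "selfadj_op (poly_op q A)"
proof (induction q)
  case (pCons a q)
  have "cinner (A (poly_op q A x)) y = cinner x (A (poly_op q A y))" for x y
    using pCons.IH A by (metis poly_op_commute selfadj_op_cinner)
  then have "selfadj_op (A o\<^sub>L poly_op q A)"
    using pCons.IH A by (simp add: selfadj_op_def clinear_op_compose)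
  then show ?case
    by (simp add: poly_op_pCons selfadj_op_intros)
qed simp

text \<open>
  Locating a spectral value needs the factorisation of a polynomial over \<open>\<complex>\<close>, hence polynomials
  with complex coefficients applied to a vector.
\<close>

definition cpoly_apply :: "('a::complex_hilbert_space \<Rightarrow>\<^sub>L 'a) \<Rightarrow> complex poly \<Rightarrow> 'a \<Rightarrow> 'a" where
  "cpoly_apply A r = fold_coeffs (\<lambda>a f x. a *\<^sub>C x + A (f x)) r (\<lambda>x. 0)"

lemma cpoly_apply_0 [simp]: "cpoly_apply A 0 x = 0"
  by (simp add: cpoly_apply_def)

lemma cpoly_apply_pCons: "cpoly_apply A (pCons a r) x = a *\<^sub>C x + A (cpoly_apply A r x)"
  by (cases "r = 0 \<and> a = 0") (auto simp: cpoly_apply_def)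

lemma cpoly_apply_add: "cpoly_apply A (q + r) x = cpoly_apply A q x + cpoly_apply A r x"
  by (induction q r rule: poly_induct2)
    (simp_all add: cpoly_apply_pCons blinfun.bilinear_simps scaleC_add_left)

lemma cpoly_apply_smult:
  "clinear_op A \<Longrightarrow> cpoly_apply A (smult c r) x = c *\<^sub>C cpoly_apply A r x"
  by (induction r) (simp_all add: cpoly_apply_pCons scaleC_add_right clinear_opD)

lemma cpoly_apply_linear_factor:
  assumes "clinear_op A"
  shows "cpoly_apply A ([:- c, 1:] * r) x = A (cpoly_apply A r x) - c *\<^sub>C cpoly_apply A r x"
  using cpoly_apply_smult[OF assms, of "-c" r x]
  by (simp add: cpoly_apply_add[of A "- smult c r" "pCons 0 r", simplified] cpoly_apply_pCons
      cspace.scale_minus_left)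

lemma cpoly_apply_of_real: "cpoly_apply A (map_poly complex_of_real q) x = poly_op q A x"
  by (induction q)
    (simp_all add: cpoly_apply_pCons poly_op_pCons map_poly_pCons scaleC_of_real blinfun.bilinear_simps)

lemma poly_map_poly_of_real:
  "poly (map_poly complex_of_real q) (complex_of_real x) = complex_of_real (poly q x)"
  by (induction q) (simp_all add: map_poly_pCons)

definition bounded_below :: "('a::real_normed_vector \<Rightarrow> 'a) \<Rightarrow> bool" where
  "bounded_below f \<longleftrightarrow> (\<exists>\<delta>>0. \<forall>x. \<delta> * norm x \<le> norm (f x))"

lemma bounded_below_comp:
  assumes "bounded_below f" "bounded_below g"
  shows "bounded_below (\<lambda>x. f (g x))"
proof -
  obtain a b where a: "a > 0" "\<And>x. a * norm x \<le> norm (f x)"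
    and b: "b > 0" "\<And>x. b * norm x \<le> norm (g x)"
    using assms unfolding bounded_below_def by blast
  have "(a * b) * norm x \<le> norm (f (g x))" for x
  proof -
    have "a * (b * norm x) \<le> a * norm (g x)"
      using a(1) b(2) by (simp add: mult_left_mono)
    then show ?thesis
      using a(2)[of "g x"] by (simp add: mult.assoc)
  qed
  then show ?thesis
    unfolding bounded_below_def using a(1) b(1) by (intro exI[of _ "a * b"]) simp
qed

lemma cpoly_bounded_below:
  assumes A: "clinear_op A" and "r \<noteq> 0"
    and roots: "\<And>c. poly r c = 0 \<Longrightarrow> bounded_below (\<lambda>x. A x - c *\<^sub>C x)"
  shows "bounded_below (cpoly_apply A r)"
  using assms(2,3)
proof (induction "degree r" arbitrary: r)
  case 0
  then obtain c where c: "r = [:c:]" "c \<noteq> 0"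
    by (metis degree_eq_zeroE pCons_0_0)
  then show ?case
    unfolding bounded_below_def by (intro exI[of _ "cmod c"]) (simp add: cpoly_apply_pCons)
next
  case (Suc n)
  then obtain c where c: "poly r c = 0"
    using fundamental_theorem_of_algebra[of r] by (auto simp: constant_degree)
  then obtain s where s: "r = [:- c, 1:] * s"
    unfolding poly_eq_0_iff_dvd by (rule dvdE)
  have "s \<noteq> 0"
    using Suc.prems(1) s by auto
  moreover from this have "degree s = n"
    using Suc.hyps(2) unfolding s by (subst (asm) degree_mult_eq) auto
  moreover have "bounded_below (\<lambda>x. A x - d *\<^sub>C x)" if "poly s d = 0" for d
    using Suc.prems(2)[of d] that unfolding s poly_mult by simp
  ultimately have "bounded_below (cpoly_apply A s)"
    using Suc.hyps(1)[of s] by simp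
  then show ?case
    unfolding s cpoly_apply_linear_factor[OF A, abs_def]
    by (rule bounded_below_comp[OF Suc.prems(2)[OF c]])
qed

lemma selfadj_bounded_below:
  assumes A: "selfadj_op A"
    and c: "\<And>x. c = complex_of_real x \<Longrightarrow> complex_of_real x \<notin> op_spectrum A"
  shows "bounded_below (\<lambda>x. A x - c *\<^sub>C x)"
proof (cases "Im c = 0")
  case True
  then have "c = complex_of_real (Re c)"
    by (simp add: complex_eq_iff)
  then have "c \<notin> op_spectrum A"
    using c by metis
  then obtain B :: "'a \<Rightarrow>\<^sub>L 'a" where B: "\<And>x. B (A x - c *\<^sub>C x) = x"
    by (auto simp: op_spectrum_def)
  have "1 / (norm B + 1) * norm x \<le> norm (A x - c *\<^sub>C x)" for x
  proof -
    have "norm x \<le> norm B * norm (A x - c *\<^sub>C x)"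
      by (metis B norm_blinfun)
    also have "\<dots> \<le> (norm B + 1) * norm (A x - c *\<^sub>C x)"
      by (simp add: mult_right_mono)
    finally show ?thesis
      by (simp add: field_simps add_pos_nonneg)
  qed
  then show ?thesis
    unfolding bounded_below_def
    by (intro exI[of _ "1 / (norm B + 1)"]) (simp add: add_nonneg_pos)
next
  case False
  \<comment> \<open>The imaginary part of \<open>\<langle>(A - c) x, x\<rangle>\<close> is \<open>- Im c \<cdot> \<parallel>x\<parallel>\<^sup>2\<close>.\<close>
  have "\<bar>Im c\<bar> * norm x \<le> norm (A x - c *\<^sub>C x)" for x
  proof -
    have "\<bar>Im c\<bar> * (norm x)\<^sup>2 = \<bar>Im (cinner (A x - c *\<^sub>C x) x)\<bar>"
      by (simp add: cinner_algebra cinner_self selfadj_op_cinner_self[OF A] abs_mult flip: of_real_power)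
    also have "\<dots> \<le> norm (A x - c *\<^sub>C x) * norm x"
      by (meson abs_Im_le_cmod norm_cinner_le order_trans)
    finally show ?thesis
      by (cases "x = 0") (auto simp: power2_eq_square)
  qed
  then show ?thesis
    unfolding bounded_below_def using False by (intro exI[of _ "\<bar>Im c\<bar>"]) simp
qed

text \<open>
  With \<open>S = q(A)\<close> and \<open>M = \<parallel>S\<parallel>\<close>, the operator \<open>S\<^sup>2 - M\<^sup>2\<close> is not bounded below, because
  \<open>\<parallel>S\<^sup>2 x - M\<^sup>2 x\<parallel>\<^sup>2 \<le> M\<^sup>2 (M\<^sup>2 \<parallel>x\<parallel>\<^sup>2 - \<parallel>S x\<parallel>\<^sup>2)\<close>, and the right-hand side is
  arbitrarily small for suitable unit vectors \<open>x\<close>. Factorising \<open>q\<^sup>2 - M\<^sup>2\<close> over \<open>\<complex>\<close>, some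
  \<open>A - c\<close> with \<open>q(c)\<^sup>2 = M\<^sup>2\<close> is not bounded below either, and such a \<open>c\<close> is real and in the
  spectrum.
\<close>

lemma norm_poly_op_attained:
  fixes A :: "'a::complex_hilbert_space \<Rightarrow>\<^sub>L 'a" and v :: 'a
  assumes A: "selfadj_op A" and "degree q > 0" and "v \<noteq> 0"
  shows "\<exists>x. complex_of_real x \<in> op_spectrum A \<and> \<bar>poly q x\<bar> = norm (poly_op q A)"
proof (rule ccontr)
  assume no: "\<not> ?thesis"
  define S where "S = poly_op q A"
  define M where "M = norm S"
  define r where "r = q * q - [:M\<^sup>2:]"
  define rc where "rc = map_poly complex_of_real r"
  have "degree (q * q) > 0"
    using \<open>degree q > 0\<close> by (metis add_gr_0 degree_0 degree_mult_eq less_numeral_extra(3))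
  then have "r \<noteq> 0"
    unfolding r_def by (metis degree_pCons_0 eq_iff_diff_eq_0 less_numeral_extra(3))
  then have "rc \<noteq> 0"
    by (metis (no_types, lifting) coeff_map_poly of_real_0 of_real_eq_0_iff poly_eqI rc_def coeff_0)
  have rc_x: "cpoly_apply A rc x = S (S x) - M\<^sup>2 *\<^sub>R x" for x
    by (simp add: rc_def r_def cpoly_apply_of_real poly_op_diff poly_op_mult poly_op_pCons S_def
        blinfun.bilinear_simps)
  have "bounded_below (\<lambda>x. A x - c *\<^sub>C x)" if "poly rc c = 0" for c
  proof (rule selfadj_bounded_below[OF A])
    fix x assume "c = complex_of_real x"
    then have "complex_of_real (poly r x) = 0"
      using that by (simp add: rc_def poly_map_poly_of_real)
    then have "poly r x = 0"
      by (simp only: of_real_eq_0_iff)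
    then have "(poly q x)\<^sup>2 = M\<^sup>2"
      by (simp add: r_def power2_eq_square)
    then have "\<bar>poly q x\<bar> = norm (poly_op q A)"
      by (metis M_def S_def abs_norm_cancel power2_eq_iff_nonneg abs_ge_zero power2_abs)
    then show "complex_of_real x \<notin> op_spectrum A"
      using no by blast
  qed
  then have "bounded_below (cpoly_apply A rc)"
    using cpoly_bounded_below[OF selfadj_op_clinear[OF A] \<open>rc \<noteq> 0\<close>] by blast
  then obtain \<delta> where "\<delta> > 0" and \<delta>: "\<And>x. \<delta> * norm x \<le> norm (S (S x) - M\<^sup>2 *\<^sub>R x)"
    by (auto simp: bounded_below_def rc_x)
  have S: "selfadj_op S"
    by (simp add: S_def selfadj_poly_op A)
  have key: "M\<^sup>2 * (norm (S x))\<^sup>2 \<le> (M\<^sup>2 * M\<^sup>2 - \<delta>\<^sup>2) * (norm x)\<^sup>2" for x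
  proof -
    have SS: "(norm (S (S x)))\<^sup>2 \<le> M\<^sup>2 * (norm (S x))\<^sup>2"
      by (metis M_def norm_blinfun norm_ge_zero power_mono power_mult_distrib)
    have "\<delta>\<^sup>2 * (norm x)\<^sup>2 \<le> (norm (S (S x) - M\<^sup>2 *\<^sub>R x))\<^sup>2"
      by (metis \<delta> \<open>\<delta> > 0\<close> less_imp_le mult_nonneg_nonneg norm_ge_zero power_mono power_mult_distrib)
    also have "\<dots> = (norm (S (S x)))\<^sup>2 - 2 * M\<^sup>2 * (norm (S x))\<^sup>2 + M\<^sup>2 * M\<^sup>2 * (norm x)\<^sup>2"
      by (simp add: power2_norm_eq_inner inner_diff_left inner_diff_right inner_commute
          selfadj_op_inner[OF S, of x "S x"])
    finally show ?thesis
      using SS by (simp add: algebra_simps)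
  qed
  have v: "(norm v)\<^sup>2 > 0" using \<open>v \<noteq> 0\<close> by simp
  have M: "M > 0"
  proof (rule ccontr)
    assume "\<not> M > 0"
    then have "M = 0" by (simp add: M_def)
    then show False
      using key[of v] v \<open>\<delta> > 0\<close> by (simp add: mult_le_0_iff)
  qed
  define k where "k = M\<^sup>2 - \<delta>\<^sup>2 / M\<^sup>2"
  have kx: "(norm (S x))\<^sup>2 \<le> k * (norm x)\<^sup>2" for x
  proof -
    have "M\<^sup>2 * (norm (S x))\<^sup>2 \<le> M\<^sup>2 * (k * (norm x)\<^sup>2)"
      using key[of x] M by (simp add: k_def right_diff_distrib left_diff_distrib)
    then show ?thesis
      using M by simp
  qed
  have "0 \<le> k * (norm v)\<^sup>2"
    using kx[of v] by (meson order_trans zero_le_power2)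
  then have "k \<ge> 0"
    using v by (simp add: zero_le_mult_iff)
  have "norm (S x) \<le> sqrt k * norm x" for x
    using kx[of x] \<open>k \<ge> 0\<close> by (metis abs_norm_cancel real_sqrt_abs real_sqrt_le_iff real_sqrt_mult)
  then have "M \<le> sqrt k"
    unfolding M_def using \<open>k \<ge> 0\<close> by (intro norm_blinfun_bound) auto
  then have "M\<^sup>2 \<le> k"
    using M \<open>k \<ge> 0\<close> by (metis less_imp_le power_mono real_sqrt_pow2)
  then show False
    using M \<open>\<delta> > 0\<close> by (simp add: k_def divide_le_0_iff)
qed

lemma norm_poly_op_le:
  fixes A :: "'a::complex_hilbert_space \<Rightarrow>\<^sub>L 'a"
  assumes A: "selfadj_op A" and "e \<ge> 0"
    and bound: "\<And>x. complex_of_real x \<in> op_spectrum A \<Longrightarrow> \<bar>poly q x\<bar> \<le> e"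
  shows "norm (poly_op q A) \<le> e"
proof (cases "\<exists>v :: 'a. v \<noteq> 0")
  case False
  then show ?thesis
    using \<open>e \<ge> 0\<close> by (intro norm_blinfun_bound) (metis mult_zero_right norm_zero order_refl, metis mult_zero_right norm_zero order_refl)
next
  case True
  then obtain v :: 'a where v: "v \<noteq> 0" by blast
  show ?thesis
  proof (cases "degree q > 0")
    case True
    then show ?thesis
      using norm_poly_op_attained[OF A True v] bound by metis
  next
    case False
    then obtain c where c: "q = [:c:]"
      by (metis degree_eq_zeroE gr0I)
    \<comment> \<open>The spectrum is not empty, as seen from the polynomial \<open>X\<close>.\<close>
    obtain x where "complex_of_real x \<in> op_spectrum A"
      using norm_poly_op_attained[OF A _ v, of "[:0, 1:]"] by auto
    then have "\<bar>c\<bar> \<le> e"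
      using bound c by fastforce
    then show ?thesis
      unfolding c using \<open>e \<ge> 0\<close>
      by (intro norm_blinfun_bound) (auto simp: poly_op_pCons blinfun.bilinear_simps mult_right_mono)
  qed
qed

section \<open>The functional calculus for the functions \<open>f\<^sub>p\<close>\<close>

lemma effects_spectrum:
  assumes A: "A \<in> effects" and x: "complex_of_real x \<in> op_spectrum A"
  shows "0 \<le> x" "x \<le> 1"
proof -
  have lin: "clinear_op A" by (simp add: A effects_selfadj selfadj_op_clinear)
  show "0 \<le> x"
  proof (rule ccontr)
    assume "\<not> 0 \<le> x"
    then have "- x > 0" by simp
    then obtain G where G: "clinear_op G" "(A - x *\<^sub>R id_blinfun) o\<^sub>L G = id_blinfun"
      "G o\<^sub>L (A - x *\<^sub>R id_blinfun) = id_blinfun"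
    proof (rule coercive_bij[rotated])
      show "clinear_op (A - x *\<^sub>R id_blinfun)"
        by (simp add: clinear_op_diff clinear_op_scaleR lin)
      show "- x * (norm y)\<^sup>2 \<le> inner ((A - x *\<^sub>R id_blinfun) y) y" for y
        using effects_nonneg[OF A, of y]
        by (simp add: blinfun.bilinear_simps inner_diff_left power2_norm_eq_inner)
    qed
    then have "G (A y - x *\<^sub>R y) = y" "A (G y) - x *\<^sub>R G y = y" for y
      by (auto dest!: arg_cong[where f = "\<lambda>B. blinfun_apply B y"] simp: blinfun.bilinear_simps)
    then show False
      using x G(1) by (auto simp: op_spectrum_def scaleC_of_real)
  qed
  show "x \<le> 1"
  proof (rule ccontr)
    assume "\<not> x \<le> 1"
    then have "x - 1 > 0" by simp
    then obtain G where G: "clinear_op G" "(x *\<^sub>R id_blinfun - A) o\<^sub>L G = id_blinfun"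
      "G o\<^sub>L (x *\<^sub>R id_blinfun - A) = id_blinfun"
    proof (rule coercive_bij[rotated])
      show "clinear_op (x *\<^sub>R id_blinfun - A)"
        by (simp add: clinear_op_diff clinear_op_scaleR lin)
      show "(x - 1) * (norm y)\<^sup>2 \<le> inner ((x *\<^sub>R id_blinfun - A) y) y" for y
        using effects_le_norm[OF A, of y]
        by (simp add: blinfun.bilinear_simps inner_diff_left left_diff_distrib power2_norm_eq_inner)
    qed
    then have *: "G (x *\<^sub>R y - A y) = y" "x *\<^sub>R G y - A (G y) = y" for y
      by (auto dest!: arg_cong[where f = "\<lambda>B. blinfun_apply B y"] simp: blinfun.bilinear_simps)
    have "(- G) (A y - x *\<^sub>R y) = y" "A ((- G) y) - x *\<^sub>R (- G) y = y" for y
      using *[of y] by (simp_all add: blinfun.bilinear_simps)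
    moreover have "clinear_op (- G)"
      using clinear_op_scaleR[OF G(1), of "-1"] by simp
    ultimately show False
      using x by (auto simp: op_spectrum_def scaleC_of_real)
  qed
qed

lemma polynomial_approximation:
  fixes f :: "real \<Rightarrow> real"
  assumes "compact K" "continuous_on K f"
  obtains q where "uniform_limit K (\<lambda>n. poly (q n)) f sequentially"
proof -
  have "\<exists>q. \<forall>x\<in>K. \<bar>f x - poly q x\<bar> < inverse (real (Suc n))" for n
  proof -
    obtain g where g: "real_polynomial_function g" "\<And>x. x \<in> K \<Longrightarrow> \<bar>f x - g x\<bar> < inverse (real (Suc n))"
      using Stone_Weierstrass_real_polynomial_function[OF assms, of "inverse (real (Suc n))"] by auto
    obtain a m where "g = (\<lambda>x. \<Sum>i\<le>m. a i * x ^ i)"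
      using g(1) real_polynomial_function_iff_sum by auto
    then have "g x = poly (\<Sum>i\<le>m. monom (a i) i) x" for x
      by (simp add: poly_sum poly_monom)
    then show ?thesis
      using g(2) by metis
  qed
  then obtain q where q: "\<And>n x. x \<in> K \<Longrightarrow> \<bar>f x - poly (q n) x\<bar> < inverse (real (Suc n))"
    by metis
  have "uniform_limit K (\<lambda>n. poly (q n)) f sequentially"
  proof (rule uniform_limitI)
    fix e :: real assume "e > 0"
    have "\<forall>\<^sub>F n in sequentially. inverse (real (Suc n)) < e"
      using order_tendstoD(2)[OF LIMSEQ_inverse_real_of_nat \<open>e > 0\<close>] .
    then show "\<forall>\<^sub>F n in sequentially. \<forall>x\<in>K. dist (poly (q n) x) (f x) < e"
    proof eventually_elim
      case (elim n)
      then show ?case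
        using q by (metis dist_commute dist_real_def order.strict_trans)
    qed
  qed
  then show thesis by (rule that)
qed

definition f_denom :: "real \<Rightarrow> ('a::complex_hilbert_space \<Rightarrow>\<^sub>L 'a) \<Rightarrow> ('a \<Rightarrow>\<^sub>L 'a)" where
  "f_denom p A = p *\<^sub>R A + (1 - p) *\<^sub>R id_blinfun"

lemma f_denom_apply: "f_denom p A x = p *\<^sub>R A x + (1 - p) *\<^sub>R x"
  by (simp add: f_denom_def blinfun.bilinear_simps)

lemma f_fun_denom_pos:
  fixes p x :: real
  assumes "p < 1" "0 \<le> x" "x \<le> 1"
  shows "min 1 (1 - p) \<le> x * p + (1 - p)" "0 < x * p + (1 - p)"
proof -
  have "x * p + (1 - p) = x * 1 + (1 - x) * (1 - p)"
    by (simp add: algebra_simps)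
  also have "\<dots> \<ge> x * min 1 (1 - p) + (1 - x) * min 1 (1 - p)"
    using assms by (intro add_mono mult_left_mono) auto
  finally show *: "min 1 (1 - p) \<le> x * p + (1 - p)"
    by (simp add: algebra_simps)
  show "0 < x * p + (1 - p)"
    using * assms(1) by linarith
qed

lemma f_denom_bij:
  assumes A: "A \<in> effects" and p: "p < 1"
  obtains G where "clinear_op G" "f_denom p A o\<^sub>L G = id_blinfun" "G o\<^sub>L f_denom p A = id_blinfun"
proof (rule coercive_bij)
  show "clinear_op (f_denom p A)"
    unfolding f_denom_def by (simp add: clinear_op_add clinear_op_scaleR A effects_selfadj selfadj_op_clinear)
  show "min 1 (1 - p) > 0" using p by simp
  fix x
  have "min 1 (1 - p) * (norm x)\<^sup>2 \<le> p * inner (A x) x + (1 - p) * (norm x)\<^sup>2"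
  proof (cases "p \<ge> 0")
    case True
    then show ?thesis
      using effects_nonneg[OF A, of x] by simp
  next
    case False
    then have "p * inner (A x) x \<ge> p * (norm x)\<^sup>2"
      using effects_le_norm[OF A, of x] by (simp add: mult_left_mono_neg)
    then show ?thesis
      using False by (simp add: algebra_simps)
  qed
  then show "min 1 (1 - p) * (norm x)\<^sup>2 \<le> inner (f_denom p A x) x"
    by (simp add: f_denom_apply inner_add_left power2_norm_eq_inner)
qed (rule that)

text \<open>
  If \<open>q\<^sub>n\<close> tends to \<open>f\<^sub>p\<close> uniformly on the spectrum, then \<open>q\<^sub>n(x) (p x + (1 - p)) - x\<close> tends to
  \<open>0\<close> there, so \<open>q\<^sub>n(A) (p A + (1 - p))\<close> tends to \<open>A\<close> in norm. This identifies the limit of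
  \<open>q\<^sub>n(A)\<close> at once, and shows that it does not depend on the sequence.
\<close>

lemma cfc_f_fun_denom:
  assumes A: "A \<in> effects" and p: "p < 1"
  shows "cfc (f_fun p) A o\<^sub>L f_denom p A = A"
proof -
  let ?K = "{x. complex_of_real x \<in> op_spectrum A}"
  let ?f = "f_fun p"
  obtain G where G: "f_denom p A o\<^sub>L G = id_blinfun" "G o\<^sub>L f_denom p A = id_blinfun"
    using f_denom_bij[OF A p] by blast
  define T where "T = A o\<^sub>L G"
  have K: "?K \<subseteq> {0..1}"
    using effects_spectrum[OF A] by auto
  have lim: "(\<lambda>n. poly_op (q n) A) \<longlonglongrightarrow> T"
    if q: "uniform_limit ?K (\<lambda>n. poly (q n)) ?f sequentially" for q
  proof -
    define C where "C = \<bar>p\<bar> + \<bar>1 - p\<bar> + 1"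
    have C: "C > 0" by (simp add: C_def add_nonneg_pos)
    have "(\<lambda>n. poly_op (q n) A o\<^sub>L f_denom p A) \<longlonglongrightarrow> A"
    proof (rule LIMSEQ_I)
      fix e :: real assume "e > 0"
      then have "\<forall>\<^sub>F n in sequentially. \<forall>x\<in>?K. dist (poly (q n) x) (?f x) < e / (2 * C)"
        using C by (intro uniform_limitD[OF q]) simp
      then obtain N where N: "\<And>n x. n \<ge> N \<Longrightarrow> x \<in> ?K \<Longrightarrow> \<bar>poly (q n) x - ?f x\<bar> < e / (2 * C)"
        by (auto simp: eventually_sequentially dist_real_def)
      have "norm ((poly_op (q n) A o\<^sub>L f_denom p A) - A) < e" if "n \<ge> N" for n
      proof -
        let ?r = "q n * [:1 - p, p:] - [:0, 1:]"
        have "f_denom p A = poly_op [:1 - p, p:] A"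
          by (rule blinfun_eqI) (simp add: poly_op_pCons f_denom_def blinfun.bilinear_simps)
        moreover have "poly_op [:0, 1:] A = A"
          by (rule blinfun_eqI) (simp add: poly_op_pCons blinfun.bilinear_simps)
        ultimately have "(poly_op (q n) A o\<^sub>L f_denom p A) - A = poly_op ?r A"
          by (simp only: poly_op_diff poly_op_mult)
        moreover have "norm (poly_op ?r A) \<le> e / 2"
        proof (rule norm_poly_op_le[OF effects_selfadj[OF A]])
          fix x assume "complex_of_real x \<in> op_spectrum A"
          then have x: "x \<in> ?K" "0 \<le> x" "x \<le> 1" using K by auto
          have "x = ?f x * (x * p + (1 - p))"
            using f_fun_denom_pos(2)[OF p x(2,3)] by (simp add: f_fun_def)
          then have "poly ?r x = (poly (q n) x - ?f x) * (x * p + (1 - p))"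
            by (simp add: algebra_simps)
          moreover have "\<bar>x * p + (1 - p)\<bar> \<le> C"
          proof -
            have "\<bar>x * p\<bar> \<le> \<bar>p\<bar>" using x by (simp add: abs_mult mult_left_le_one_le)
            then show ?thesis unfolding C_def by linarith
          qed
          ultimately have "\<bar>poly ?r x\<bar> \<le> e / (2 * C) * C"
            using N[OF that x(1)] by (simp only: abs_mult) (intro mult_mono; simp)
          then show "\<bar>poly ?r x\<bar> \<le> e / 2"
            using C by simp
        qed (use \<open>e > 0\<close> in simp)
        ultimately show ?thesis
          using \<open>e > 0\<close> by simp
      qed
      then show "\<exists>N. \<forall>n\<ge>N. norm ((poly_op (q n) A o\<^sub>L f_denom p A) - A) < e" by blast
    qed
    then have "(\<lambda>n. (poly_op (q n) A o\<^sub>L f_denom p A) o\<^sub>L G) \<longlonglongrightarrow> (A o\<^sub>L G)"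
      by (intro tendsto_intros)
    then show ?thesis
      using G by (simp add: T_def blinfun_compose_assoc)
  qed
  have "continuous_on {0..1} ?f"
    unfolding f_fun_def using f_fun_denom_pos(2)[OF p] by (intro continuous_intros) force
  then obtain q where "uniform_limit {0..1} (\<lambda>n. poly (q n)) ?f sequentially"
    using polynomial_approximation[of "{0..1}" ?f] by auto
  then have q: "uniform_limit ?K (\<lambda>n. poly (q n)) ?f sequentially"
    using K by (rule uniform_limit_on_subset)
  have "cfc ?f A = T"
    unfolding cfc_def
  proof (rule the_equality)
    fix T'
    assume "\<forall>q. uniform_limit ?K (\<lambda>n. poly (q n)) ?f sequentially \<longrightarrow> (\<lambda>n. poly_op (q n) A) \<longlonglongrightarrow> T'"
    then show "T' = T"
      using q lim LIMSEQ_unique by blast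
  qed (use lim in blast)
  then show ?thesis
    using G by (simp add: T_def blinfun_compose_assoc)
qed

text \<open>
  The equation \<open>T (p A + (1 - p)) = A\<close> determines \<open>T\<close>. With \<open>z = (p A + (1 - p)) w\<close>, the forms of
  \<open>T\<close> and \<open>1 - T\<close> at \<open>z\<close> are \<open>a - p b\<close> for \<open>a = \<langle>A w, w\<rangle>\<close>, \<open>b = a - \<parallel>A w\<parallel>\<^sup>2\<close> and, up to
  the factor \<open>1 - p\<close>, for \<open>a = \<langle>(1 - A) w, w\<rangle>\<close>, \<open>b = \<parallel>(1 - A) w\<parallel>\<^sup>2\<close>. In both cases
  \<open>0 \<le> b \<le> a\<close>.
\<close>

lemma f_solution_effect:
  assumes A: "A \<in> effects" and p: "p < 1" and T: "T o\<^sub>L f_denom p A = A"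
  shows "T \<in> effects"
proof -
  obtain G where G: "clinear_op G" "f_denom p A o\<^sub>L G = id_blinfun" "G o\<^sub>L f_denom p A = id_blinfun"
    using f_denom_bij[OF A p] by blast
  note sA = effects_selfadj[OF A]
  have z: "p *\<^sub>R A (G z) + (1 - p) *\<^sub>R G z = z" for z
    using G(2) f_denom_apply by (metis blinfun_apply_blinfun_compose id_blinfun.rep_eq)
  have TG: "T = A o\<^sub>L G"
    by (metis G(2) T blinfun_compose_assoc blinfun_compose_id_right)
  have "clinear_op T"
    by (simp add: TG clinear_op_compose selfadj_op_clinear sA G(1))
  moreover have "cinner (T x) y = cinner x (T y)" for x y
  proof -
    have "cinner (A (G x)) (p *\<^sub>R A (G y) + (1 - p) *\<^sub>R G y)
        = cinner (p *\<^sub>R A (G x) + (1 - p) *\<^sub>R G x) (A (G y))"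
      by (simp add: cinner_add_left cinner_add_right selfadj_op_cinner[OF sA, of "G x"])
    then show ?thesis
      unfolding z by (simp add: TG)
  qed
  ultimately have sT: "selfadj_op T"
    by (simp add: selfadj_op_def)
  have form: "inner (T z) z = inner (A (G z)) (G z) - p * (inner (A (G z)) (G z) - (norm (A (G z)))\<^sup>2)"
    and form': "(norm z)\<^sup>2 - inner (T z) z
      = (1 - p) * (inner (G z - A (G z)) (G z) - p * (norm (G z - A (G z)))\<^sup>2)" for z
  proof -
    have "inner (T z) z = inner (A (G z)) (p *\<^sub>R A (G z) + (1 - p) *\<^sub>R G z)"
      by (simp only: z) (simp add: TG)
    then show 1: "inner (T z) z = inner (A (G z)) (G z) - p * (inner (A (G z)) (G z) - (norm (A (G z)))\<^sup>2)"
      by (simp add: power2_norm_eq_inner inner_add_right algebra_simps)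
    have "(norm z)\<^sup>2 = (norm (p *\<^sub>R A (G z) + (1 - p) *\<^sub>R G z))\<^sup>2"
      by (simp only: z)
    then show "(norm z)\<^sup>2 - inner (T z) z
      = (1 - p) * (inner (G z - A (G z)) (G z) - p * (norm (G z - A (G z)))\<^sup>2)"
      unfolding 1 by (simp add: power2_norm_eq_inner inner_add_right inner_add_left inner_diff_left
          inner_diff_right inner_commute) (simp add: algebra_simps)
  qed
  have *: "0 \<le> a - p * b" if "0 \<le> b" "b \<le> a" for a b :: real
  proof -
    have "p * b \<le> 1 * b" using p that by (intro mult_right_mono) auto
    then show ?thesis using that by simp
  qed
  have "0 \<le> inner (T z) z" for z
    unfolding form using effects_norm_apply[OF A, of "G z"] effects_nonneg[OF A, of "G z"]
    by (intro *) auto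
  moreover have "inner (T z) z \<le> (norm z)\<^sup>2" for z
  proof -
    have "0 \<le> inner (G z - A (G z)) (G z) - p * (norm (G z - A (G z)))\<^sup>2"
      using effects_norm_apply[OF compl_in_effects[OF A], of "G z"]
      by (intro *) (auto simp: blinfun.bilinear_simps)
    then show ?thesis
      using form'[of z] p by (metis diff_ge_0_iff_ge less_imp_le mult_nonneg_nonneg)
  qed
  ultimately show ?thesis
    by (simp add: effects_iff sT)
qed

text \<open>The inverse of \<open>f\<^sub>p\<close> is \<open>f\<^sub>q\<close> for \<open>q = - p / (1 - p)\<close>, also for operators.\<close>

lemma f_solution_inverse:
  assumes A: "A \<in> effects" and p: "p < 1" and T: "T o\<^sub>L f_denom p A = A"
  shows "A o\<^sub>L f_denom (- p / (1 - p)) T = T"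
proof (rule blinfun_eqI)
  fix x
  obtain G where G: "f_denom p A o\<^sub>L G = id_blinfun"
    using f_denom_bij[OF A p] by blast
  define w where "w = G x"
  have x: "x = f_denom p A w"
    using G by (metis blinfun_apply_blinfun_compose id_blinfun.rep_eq w_def)
  have Tx: "T x = A w"
    by (metis T blinfun_apply_blinfun_compose x)
  have q: "1 - - p / (1 - p) = 1 / (1 - p)"
    using p by (simp add: field_simps)
  have "f_denom (- p / (1 - p)) T x = (1 / (1 - p)) *\<^sub>R (x - p *\<^sub>R A w)"
    unfolding f_denom_apply q Tx by (simp add: scaleR_diff_right)
  also have "x - p *\<^sub>R A w = (1 - p) *\<^sub>R w"
    by (simp add: x f_denom_apply)
  also have "(1 / (1 - p)) *\<^sub>R (1 - p) *\<^sub>R w = w"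
    using p by simp
  finally have "f_denom (- p / (1 - p)) T x = w" .
  then show "(A o\<^sub>L f_denom (- p / (1 - p)) T) x = T x"
    by (simp add: Tx)
qed

section \<open>Rank one effects\<close>

lemma effects_antisym:
  assumes "A \<in> effects" "B \<in> effects" "A \<preceq> B" "B \<preceq> A"
  shows "A = B"
proof -
  have eq: "inner (A x) x = inner (B x) x" for x
    using assms effects_le_iff by (metis antisym)
  have "(A - B) x = 0" for x
    using eq assms
    by (intro positive_form_kernel)
      (simp_all add: selfadj_op_diff effects_selfadj blinfun.diff_left inner_diff_left)
  then show ?thesis
    by (auto intro: blinfun_eqI simp: blinfun.diff_left)
qed

lemma effects_le_refl: "A \<in> effects \<Longrightarrow> A \<preceq> A"
  by (simp add: effects_le_iff)

lemma op_le_compl: "id_blinfun - A \<preceq> id_blinfun - B \<longleftrightarrow> B \<preceq> A"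
  by (simp add: op_le_def)

definition rank_one :: "'a::complex_hilbert_space \<Rightarrow> ('a \<Rightarrow>\<^sub>L 'a)" where
  "rank_one x = Blinfun (\<lambda>z. cinner z x *\<^sub>C x)"

lemma rank_one_apply: "rank_one x z = cinner z x *\<^sub>C x"
  unfolding rank_one_def
  by (rule bounded_linear_Blinfun_apply[THEN fun_cong],
      rule bounded_linear_compose[OF bounded_linear_scaleC_left bounded_linear_cinner_left])

lemma rank_one_scaleC: "rank_one (c *\<^sub>C x) = (cmod c)\<^sup>2 *\<^sub>R rank_one x"
proof (rule blinfun_eqI)
  fix z
  have "rank_one (c *\<^sub>C x) z = (c * cnj c) *\<^sub>C rank_one x z"
    by (simp add: rank_one_apply cinner_scaleC_right mult.commute mult.left_commute)
  then show "rank_one (c *\<^sub>C x) z = ((cmod c)\<^sup>2 *\<^sub>R rank_one x) z"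
    by (simp add: mult_cnj blinfun.scaleR_left flip: of_real_power) (metis scaleC_of_real)
qed

lemma rank_one_phase: "cmod c = 1 \<Longrightarrow> rank_one (c *\<^sub>C x) = rank_one x"
  by (simp add: rank_one_scaleC)

lemma selfadj_rank_one: "selfadj_op (rank_one x)"
  unfolding selfadj_op_def clinear_op_def
  by (simp add: rank_one_apply cinner_algebra mult.commute flip: cinner_commute[of x])

lemma rank_one_form: "inner ((t *\<^sub>R rank_one x) z) z = t * (cmod (cinner z x))\<^sup>2"
proof -
  have "cinner (rank_one x z) z = cinner z x * cnj (cinner z x)"
    by (simp add: rank_one_apply cinner_algebra flip: cinner_commute)
  then have "inner (rank_one x z) z = (cmod (cinner z x))\<^sup>2"
    by (simp add: inner_eq_Re_cinner mult_cnj flip: of_real_power)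
  then show ?thesis
    by (simp add: blinfun.scaleR_left)
qed

lemma scaled_rank_one_effect:
  assumes "norm x = 1" "0 \<le> t" "t \<le> 1"
  shows "t *\<^sub>R rank_one x \<in> effects"
proof -
  have "t * (cmod (cinner z x))\<^sup>2 \<le> (norm z)\<^sup>2" for z
  proof -
    have "(cmod (cinner z x))\<^sup>2 \<le> (norm z)\<^sup>2"
      using norm_cinner_le[of z x] assms(1) by (simp add: power_mono)
    then show ?thesis
      using assms by (meson mult_left_le_one_le order_trans zero_le_power2)
  qed
  then show ?thesis
    using assms by (simp add: effects_iff selfadj_op_scaleR selfadj_rank_one rank_one_form)
qed

lemma rank_one_effect: "norm x = 1 \<Longrightarrow> rank_one x \<in> effects"
  using scaled_rank_one_effect[of x 1] by simp

lemma scaled_rank_one_le_iff: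
  assumes "selfadj_op A"
  shows "t *\<^sub>R rank_one x \<preceq> A \<longleftrightarrow> (\<forall>z. t * (cmod (cinner z x))\<^sup>2 \<le> inner (A z) z)"
  using assms by (simp add: op_le_iff selfadj_op_scaleR selfadj_rank_one rank_one_form)

text \<open>
  The largest multiple of \<open>rank_one x\<close> below \<open>A\<close> is \<open>1 / \<langle>A\<^sup>-\<^sup>1 x, x\<rangle>\<close>: the bound is the
  Cauchy--Schwarz inequality for the form of \<open>A\<close>, and it is attained at \<open>A\<^sup>-\<^sup>1 x\<close>. A
  preimage \<open>y\<close> of \<open>x\<close> takes the place of \<open>A\<^sup>-\<^sup>1 x\<close>.
\<close>

lemma strength_iff:
  assumes A: "selfadj_op A" and pos: "\<And>z. 0 \<le> inner (A z) z" and y: "A y = x" and "t \<ge> 0"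
  shows "t *\<^sub>R rank_one x \<preceq> A \<longleftrightarrow> t * inner y x \<le> 1"
proof -
  define m where "m = inner y x"
  have m: "m \<ge> 0" "cinner x y = complex_of_real m"
    using pos[of y] selfadj_op_cinner_self[OF A, of y] by (simp_all add: y m_def inner_commute)
  have "t * m \<le> 1" if "\<forall>z. t * (cmod (cinner z x))\<^sup>2 \<le> inner (A z) z"
  proof -
    have "t * m\<^sup>2 \<le> m"
      using spec[OF that, of y] m by (simp add: cmod_cinner_commute[of y] y m_def inner_commute)
    then show ?thesis
      using m(1) by (cases "m = 0") (auto simp: power2_eq_square mult.assoc[symmetric])
  qed
  moreover have "t * (cmod (cinner z x))\<^sup>2 \<le> inner (A z) z" if "t * m \<le> 1" for z
  proof -
    have "(cmod (cinner z x))\<^sup>2 \<le> inner (A z) z * m"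
      using positive_form_Cauchy_Schwarz[OF A pos, of z y]
      by (simp add: selfadj_op_cinner[OF A] y m_def inner_commute)
    then have "t * (cmod (cinner z x))\<^sup>2 \<le> t * (inner (A z) z * m)"
      using \<open>t \<ge> 0\<close> by (rule mult_left_mono)
    also have "\<dots> = (t * m) * inner (A z) z" by simp
    also have "\<dots> \<le> 1 * inner (A z) z"
      using that pos by (rule mult_right_mono)
    finally show ?thesis by simp
  qed
  ultimately show ?thesis
    unfolding scaled_rank_one_le_iff[OF A] m_def by blast
qed

text \<open>
  The vector \<open>A a\<close> has the preimage \<open>a\<close>, so \<open>strength_iff\<close> yields a rank one effect below \<open>A\<close>. Its
  form agrees with that of \<open>A\<close> at \<open>a\<close>.
\<close>

lemma rank_one_below_effect:
  assumes A: "A \<in> effects" and "A a \<noteq> 0"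
  obtains t x where "norm x = 1" "0 < t" "t \<le> 1" "t *\<^sub>R rank_one x \<preceq> A"
    "A a = norm (A a) *\<^sub>R x" "t * (cmod (cinner a x))\<^sup>2 = inner (A a) a"
proof
  define m where "m = inner (A a) a"
  define n where "n = norm (A a)"
  define x where "x = (1 / n) *\<^sub>R A a"
  have "m \<noteq> 0" using effects_kernel[OF A, of a] assms(2) by (auto simp: m_def)
  then have m: "m > 0" using effects_nonneg[OF A, of a] by (simp add: m_def)
  have n: "n > 0" using assms(2) by (simp add: n_def)
  show x: "norm x = 1" using n by (simp add: x_def n_def)
  show Ax: "A a = norm (A a) *\<^sub>R x" using n by (simp add: x_def n_def)
  show "0 < n\<^sup>2 / m" using m n by simp
  show "n\<^sup>2 / m \<le> 1"
    using effects_norm_apply[OF A, of a] m by (simp add: n_def m_def)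
  have ip: "A ((1 / n) *\<^sub>R a) = x" "inner ((1 / n) *\<^sub>R a) x = m / n\<^sup>2"
    using n by (simp_all add: x_def m_def blinfun.scaleR_right inner_commute power2_eq_square)
  show "(n\<^sup>2 / m) *\<^sub>R rank_one x \<preceq> A"
    using strength_iff[OF effects_selfadj[OF A] effects_nonneg[OF A] ip(1), of "n\<^sup>2 / m"] m n
    unfolding ip(2) by simp
  have "cinner a x = complex_of_real (m / n)"
    using selfadj_op_cinner_self[OF effects_selfadj[OF A], of a] cinner_commute[of a "A a"]
    by (simp add: x_def m_def)
  then show "n\<^sup>2 / m * (cmod (cinner a x))\<^sup>2 = inner (A a) a"
    using m n by (simp add: m_def[symmetric] power2_eq_square norm_divide)
qed

text \<open>
  An effect is the supremum of the rank one effects below it, as for every vector one of them has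
  the same form there.
\<close>

lemma effects_le_rank_one:
  assumes A: "A \<in> effects" and B: "B \<in> effects"
    and le: "\<And>t x. norm x = 1 \<Longrightarrow> 0 \<le> t \<Longrightarrow> t \<le> 1 \<Longrightarrow> t *\<^sub>R rank_one x \<preceq> A \<Longrightarrow> t *\<^sub>R rank_one x \<preceq> B"
  shows "A \<preceq> B"
proof -
  have "inner (A a) a \<le> inner (B a) a" for a
  proof (cases "A a = 0")
    case True
    then show ?thesis using effects_nonneg[OF B] by simp
  next
    case False
    then obtain t x where "norm x = 1" "0 < t" "t \<le> 1" "t *\<^sub>R rank_one x \<preceq> A"
      "t * (cmod (cinner a x))\<^sup>2 = inner (A a) a"
      using rank_one_below_effect[OF A] by metis
    then show ?thesis
      using le[of x t] scaled_rank_one_le_iff[OF effects_selfadj[OF B]] by (metis less_imp_le)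
  qed
  then show ?thesis
    by (simp add: effects_le_iff A B)
qed

lemma scaled_rank_one_le_rank_one:
  assumes x: "norm x = 1" and y: "norm y = 1" and "t > 0" and le: "t *\<^sub>R rank_one x \<preceq> s *\<^sub>R rank_one y"
  shows "cmod (cinner x y) = 1" "x = cinner x y *\<^sub>C y" "rank_one x = rank_one y" "t \<le> s"
proof -
  define z where "z = x - cinner x y *\<^sub>C y"
  have le': "t * (cmod (cinner w x))\<^sup>2 \<le> s * (cmod (cinner w y))\<^sup>2" for w
    using le scaled_rank_one_le_iff[of "s *\<^sub>R rank_one y"]
    by (simp add: rank_one_form selfadj_op_scaleR selfadj_rank_one)
  have zy: "cinner z y = 0" unfolding z_def by (rule cinner_residual(1)[OF y])
  then have "t * (cmod (cinner z x))\<^sup>2 \<le> 0" using le'[of z] by simp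
  then have zx: "cinner z x = 0" using \<open>t > 0\<close> by (simp add: mult_le_0_iff)
  have "cinner z z = 0"
    by (subst (2) z_def) (simp add: cinner_algebra zx zy)
  then have "z = 0" by (simp add: cinner_self)
  then show xy: "x = cinner x y *\<^sub>C y" by (simp add: z_def)
  show 1: "cmod (cinner x y) = 1"
    using arg_cong[OF xy, of norm] x y by simp
  show "rank_one x = rank_one y"
    using rank_one_phase[OF 1, of y] xy by metis
  show "t \<le> s"
    using le'[of x] x 1 by (simp add: cinner_self)
qed

lemma rank_one_eq_iff:
  assumes x: "norm x = 1" and y: "norm y = 1"
  shows "rank_one x = rank_one y \<longleftrightarrow> (\<exists>c. cmod c = 1 \<and> x = c *\<^sub>C y)"
proof
  assume eq: "rank_one x = rank_one y"
  have "1 *\<^sub>R rank_one x \<preceq> 1 *\<^sub>R rank_one y"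
    using effects_le_refl[OF rank_one_effect[OF y]] eq by simp
  then show "\<exists>c. cmod c = 1 \<and> x = c *\<^sub>C y"
    using scaled_rank_one_le_rank_one[OF x y, of 1 1] by auto
qed (auto simp: rank_one_phase)

lemma rank_one_scale_le_iff:
  assumes "norm x = 1"
  shows "t *\<^sub>R rank_one x \<preceq> s *\<^sub>R rank_one x \<longleftrightarrow> t \<le> s"
proof
  assume "t *\<^sub>R rank_one x \<preceq> s *\<^sub>R rank_one x"
  then show "t \<le> s"
    using assms op_le_iff[of "t *\<^sub>R rank_one x" "s *\<^sub>R rank_one x"]
    by (auto simp: rank_one_form selfadj_op_scaleR selfadj_rank_one cinner_self dest: spec[of _ x])
qed (simp add: op_le_iff rank_one_form selfadj_op_scaleR selfadj_rank_one mult_right_mono)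

lemma below_scaled_rank_one:
  assumes x: "norm x = 1" and B: "B \<in> effects" and le: "B \<preceq> t *\<^sub>R rank_one x"
  obtains s where "0 \<le> s" "s \<le> 1" "s \<le> t" "B = s *\<^sub>R rank_one x"
proof -
  define s where "s = inner (B x) x"
  note sB = effects_selfadj[OF B]
  have le': "inner (B z) z \<le> t * (cmod (cinner z x))\<^sup>2" for z
    using le op_le_iff[OF sB selfadj_op_scaleR[OF selfadj_rank_one, of t x]] rank_one_form by metis
  have perp: "B z = 0" if "cinner z x = 0" for z
    using le'[of z] that effects_nonneg[OF B, of z] by (intro effects_kernel[OF B]) simp
  have Bz: "B z = cinner z x *\<^sub>C B x" for z
    using perp[OF cinner_residual(1)[OF x, of z]]
    by (simp add: blinfun.bilinear_simps clinear_opD[OF selfadj_op_clinear[OF sB]])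
  have "cinner (B x) w = cinner (s *\<^sub>R x) w" for w
  proof -
    have "cinner (B x) w = cnj (cinner w x) * cinner x (B x)"
      by (simp add: selfadj_op_cinner[OF sB] Bz[of w] cinner_scaleC_right)
    also have "cinner x (B x) = complex_of_real s"
      using selfadj_op_cinner_self[OF sB, of x] by (simp add: selfadj_op_cinner[OF sB] s_def)
    finally show ?thesis by (simp add: mult.commute flip: cinner_commute)
  qed
  then have "cinner (B x - s *\<^sub>R x) (B x - s *\<^sub>R x) = 0"
    by (simp add: cinner_diff_left)
  then have "B x = s *\<^sub>R x"
    by (simp add: cinner_self)
  then have "B z = (s *\<^sub>R rank_one x) z" for z
    by (simp add: Bz[of z] rank_one_apply blinfun.scaleR_left scaleC_scaleR_commute)
  then have "B = s *\<^sub>R rank_one x"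
    by (rule blinfun_eqI)
  moreover have "0 \<le> s" "s \<le> 1" "s \<le> t"
    using effects_nonneg[OF B, of x] effects_le_norm[OF B, of x] le'[of x] x
    by (simp_all add: s_def cinner_self)
  ultimately show thesis by (rule that[rotated -1])
qed

text \<open>
  The multiples of rank one projections are the effects whose lower set is a chain. If \<open>A\<close> has
  two independent vectors in its range, the corresponding rank one effects below \<open>A\<close> are
  incomparable.
\<close>

definition chain_effect :: "('a::complex_hilbert_space \<Rightarrow>\<^sub>L 'a) \<Rightarrow> bool" where
  "chain_effect A \<longleftrightarrow> A \<in> effects \<and>
    (\<forall>B\<in>effects. \<forall>C\<in>effects. B \<preceq> A \<longrightarrow> C \<preceq> A \<longrightarrow> B \<preceq> C \<or> C \<preceq> B)"

lemma chain_effect_scaled_rank_one: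
  assumes x: "norm x = 1" and t: "0 \<le> t" "t \<le> 1"
  shows "chain_effect (t *\<^sub>R rank_one x)"
  unfolding chain_effect_def
proof (intro conjI ballI impI)
  fix B C :: "'a \<Rightarrow>\<^sub>L 'a"
  assume "B \<in> effects" "C \<in> effects" "B \<preceq> t *\<^sub>R rank_one x" "C \<preceq> t *\<^sub>R rank_one x"
  then obtain s r where "B = s *\<^sub>R rank_one x" "C = r *\<^sub>R rank_one x"
    using below_scaled_rank_one[OF x] by metis
  then show "B \<preceq> C \<or> C \<preceq> B"
    using rank_one_scale_le_iff[OF x] by auto
qed (rule scaled_rank_one_effect[OF x t])

lemma chain_effectE:
  assumes A: "chain_effect A" and e: "norm (e :: 'a::complex_hilbert_space) = 1"
  obtains t x where "norm (x :: 'a) = 1" "0 \<le> t" "t \<le> 1" "A = t *\<^sub>R rank_one x"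
proof (cases "\<exists>a. A a \<noteq> 0")
  case False
  then have "A = 0 *\<^sub>R rank_one e" by (auto intro: blinfun_eqI)
  then show thesis using that[OF e, of 0] by simp
next
  case True
  then obtain a where a: "A a \<noteq> 0" by blast
  have Ae: "A \<in> effects" using A by (simp add: chain_effect_def)
  obtain t x where x: "norm x = 1" "0 < t" "t \<le> 1" "t *\<^sub>R rank_one x \<preceq> A"
    using rank_one_below_effect[OF Ae a] by metis
  have range: "\<exists>c. A b = c *\<^sub>C x" for b
  proof (cases "A b = 0")
    case True
    then show ?thesis by (metis cspace.scale_zero_left)
  next
    case False
    then obtain s y where y: "norm y = 1" "0 < s" "s \<le> 1" "s *\<^sub>R rank_one y \<preceq> A"
      "A b = norm (A b) *\<^sub>R y"
      using rank_one_below_effect[OF Ae False] by metis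
    have "t *\<^sub>R rank_one x \<preceq> s *\<^sub>R rank_one y \<or> s *\<^sub>R rank_one y \<preceq> t *\<^sub>R rank_one x"
      using A x y scaled_rank_one_effect unfolding chain_effect_def by (meson less_imp_le)
    then have "rank_one y = rank_one x"
      using scaled_rank_one_le_rank_one(3)[OF x(1) y(1) x(2)]
        scaled_rank_one_le_rank_one(3)[OF y(1) x(1) y(2)] by metis
    then obtain c where "y = c *\<^sub>C x"
      using rank_one_eq_iff[OF y(1) x(1)] by blast
    then have "norm (A b) *\<^sub>R y = (complex_of_real (norm (A b)) * c) *\<^sub>C x"
      by (simp only: scaleC_of_real[symmetric] scaleC_scaleC)
    then show ?thesis
      using y(5) by (intro exI) (rule trans)
  qed
  have sA: "selfadj_op A" by (simp add: Ae effects_selfadj)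
  have "A \<preceq> 1 *\<^sub>R rank_one x"
    unfolding op_le_iff[OF sA selfadj_op_scaleR[OF selfadj_rank_one]] rank_one_form
  proof
    fix b
    obtain c where c: "A b = c *\<^sub>C x" using range by blast
    have "inner (A b) b \<le> cmod (cinner (A b) b)"
      by (metis complex_Re_le_cmod inner_eq_Re_cinner)
    also have "\<dots> = cmod c * cmod (cinner b x)"
      by (simp add: c cinner_scaleC_left norm_mult cmod_cinner_commute[of x])
    finally have 1: "inner (A b) b \<le> cmod c * cmod (cinner b x)" .
    have 2: "(cmod c)\<^sup>2 \<le> inner (A b) b"
      using effects_norm_apply[OF Ae, of b] c x(1) by simp
    have "cmod c * cmod c \<le> cmod c * cmod (cinner b x)"
      using 1 2 by (simp add: power2_eq_square)
    then have "cmod c \<le> cmod (cinner b x)"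
      by (cases "cmod c = 0") auto
    then have "cmod c * cmod (cinner b x) \<le> (cmod (cinner b x))\<^sup>2"
      by (simp add: power2_eq_square mult_right_mono)
    then show "inner (A b) b \<le> 1 * (cmod (cinner b x))\<^sup>2"
      using 1 by simp
  qed
  then show thesis
    using below_scaled_rank_one[OF x(1) Ae] that[OF x(1)] by metis
qed

section \<open>Complements of rank one projections\<close>

lemma zero_product_rank_one_iff:
  assumes A: "A \<in> effects" and x: "norm x = 1"
  shows "A o\<^sub>L rank_one x = 0 \<longleftrightarrow> A \<preceq> id_blinfun - rank_one x"
proof -
  note sA = effects_selfadj[OF A] and lA = clinear_opD[OF selfadj_op_clinear[OF effects_selfadj[OF A]]]
  have form: "inner ((id_blinfun - rank_one x) z) z = (norm (z - cinner z x *\<^sub>C x))\<^sup>2" for z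
    using rank_one_form[of 1 x z] cinner_residual(2)[OF x, of z]
    by (simp add: blinfun.diff_left inner_diff_left power2_norm_eq_inner)
  have le: "A \<preceq> id_blinfun - rank_one x
      \<longleftrightarrow> (\<forall>z. inner (A z) z \<le> (norm (z - cinner z x *\<^sub>C x))\<^sup>2)"
    using op_le_iff[OF sA selfadj_op_diff[OF selfadj_op_id selfadj_rank_one]] form by simp
  show ?thesis
  proof
    assume "A o\<^sub>L rank_one x = 0"
    then have "(A o\<^sub>L rank_one x) x = 0" by simp
    then have Ax: "A x = 0" using x by (simp add: rank_one_apply cinner_self scaleC_one)
    have "inner (A z) z \<le> (norm (z - cinner z x *\<^sub>C x))\<^sup>2" for z
    proof -
      define w where "w = z - cinner z x *\<^sub>C x"
      have "A z = A w" by (simp add: w_def blinfun.diff_right lA Ax)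
      moreover have "inner (A w) z = inner (A w) w"
        by (simp add: selfadj_op_inner[OF sA] \<open>A z = A w\<close>)
      ultimately have "inner (A z) z = inner (A w) w" by simp
      then show ?thesis using effects_le_norm[OF A, of w] by (simp add: w_def)
    qed
    then show "A \<preceq> id_blinfun - rank_one x" by (simp add: le)
  next
    assume "A \<preceq> id_blinfun - rank_one x"
    then have "inner (A x) x \<le> (norm (x - cinner x x *\<^sub>C x))\<^sup>2" using le by blast
    then have "inner (A x) x \<le> 0" using x by (simp add: cinner_self scaleC_one)
    then have "A x = 0"
      using effects_nonneg[OF A, of x] by (intro effects_kernel[OF A]) simp
    then show "A o\<^sub>L rank_one x = 0"
      by (intro blinfun_eqI) (simp add: rank_one_apply lA)
  qed
qed

text \<open>
  With \<open>t = 1 / (1 + v)\<close> and \<open>s = u / (1 + u)\<close>, the parameters run through \<open>[0, \<infinity>)\<close> and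
  comparison becomes bilinear in \<open>u\<close> and the transition probability. The preimage of \<open>y\<close> under
  \<open>1 - s rank_one x\<close> is \<open>y + u \<langle>y, x\<rangle> x\<close>.
\<close>

lemma scaled_rank_one_le_compl_iff:
  assumes x: "norm x = 1" and y: "norm y = 1" and "u \<ge> 0" "v \<ge> 0"
  shows "(1 / (1 + v)) *\<^sub>R rank_one y \<preceq> id_blinfun - (u / (1 + u)) *\<^sub>R rank_one x
    \<longleftrightarrow> (cmod (cinner x y))\<^sup>2 * u \<le> v"
proof -
  define A where "A = id_blinfun - (u / (1 + u)) *\<^sub>R rank_one x"
  define c where "c = (cmod (cinner x y))\<^sup>2"
  define w where "w = y + u *\<^sub>R cinner y x *\<^sub>C x"
  have "A \<in> effects"
    unfolding A_def using \<open>u \<ge> 0\<close> by (intro compl_in_effects scaled_rank_one_effect[OF x]) auto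
  have wx: "cinner w x = (1 + complex_of_real u) * cinner y x"
    using x by (simp add: w_def cinner_algebra cinner_self algebra_simps)
  have "rank_one x w = (1 + u) *\<^sub>R cinner y x *\<^sub>C x"
    unfolding rank_one_apply wx by (metis of_real_1 of_real_add scaleC_of_real scaleC_scaleC)
  then have "A w = y"
    using \<open>u \<ge> 0\<close> by (simp add: A_def blinfun.bilinear_simps) (simp add: w_def)
  moreover have "inner w y = 1 + u * c"
  proof -
    have "cinner w y = cinner y y + complex_of_real u * (cinner y x * cnj (cinner y x))"
      by (simp add: w_def cinner_algebra cinner_commute[of x y])
    then have "cinner w y = complex_of_real (1 + u * c)"
      using y by (simp add: cinner_self mult_cnj c_def cmod_cinner_commute[of x])
    then show ?thesis by (simp only: inner_eq_Re_cinner Re_complex_of_real)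
  qed
  ultimately have "(1 / (1 + v)) *\<^sub>R rank_one y \<preceq> A \<longleftrightarrow> 1 / (1 + v) * (1 + u * c) \<le> 1"
    using strength_iff[of A w y] \<open>A \<in> effects\<close> \<open>v \<ge> 0\<close> by (simp add: effects_selfadj effects_nonneg)
  also have "\<dots> \<longleftrightarrow> c * u \<le> v"
    using \<open>v \<ge> 0\<close> by (simp add: field_simps)
  finally show ?thesis by (simp add: A_def c_def)
qed

section \<open>Rank one effects below \<open>f\<^sub>p(A)\<close>\<close>

lemma effects_f_denom_nonneg:
  assumes A: "A \<in> effects" and p: "p < 1"
  shows "0 \<le> inner (A (f_denom p A w)) w"
proof -
  have "p * (inner (A w) w - (norm (A w))\<^sup>2) \<le> 1 * (inner (A w) w - (norm (A w))\<^sup>2)"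
    using p effects_norm_apply[OF A, of w] by (intro mult_right_mono) auto
  then have "0 \<le> p * (norm (A w))\<^sup>2 + (1 - p) * inner (A w) w"
    by (simp add: algebra_simps) (smt (verit) zero_le_power2)
  also have "\<dots> = inner (A (f_denom p A w)) w"
    using selfadj_op_inner[OF effects_selfadj[OF A], of "A w" w]
    by (simp add: f_denom_apply blinfun.bilinear_simps inner_add_left power2_norm_eq_inner)
  finally show ?thesis .
qed

text \<open>
  For invertible \<open>A\<close> and \<open>y = A\<^sup>-\<^sup>1 x\<close> this is the identity
  \<open>\<langle>f\<^sub>p(A)\<^sup>-\<^sup>1 x, x\<rangle> = p + (1 - p) \<langle>y, x\<rangle>\<close> together with the formula for the strength. In general
  \<open>A\<close> is approximated from above by the coercive effects \<open>(1 - \<epsilon>) A + \<epsilon>\<close>; the inequality is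
  stated without inverses, for \<open>A (p A + (1 - p))\<close> in place of \<open>f\<^sub>p(A)\<close>, so that the limit only
  involves continuity of sums and products.
\<close>

lemma f_solution_rank_one_le:
  assumes A: "A \<in> effects" and p: "p < 1" and T: "T o\<^sub>L f_denom p A = A"
    and x: "norm x = 1" and t: "0 \<le> t" "t \<le> 1" and le: "t *\<^sub>R rank_one x \<preceq> A"
  shows "f_fun p t *\<^sub>R rank_one x \<preceq> T"
proof -
  define s where "s = f_fun p t"
  have den: "0 < t * p + (1 - p)" by (rule f_fun_denom_pos(2)[OF p t])
  have "s \<ge> 0" using den t by (simp add: s_def f_fun_def)
  have sA: "selfadj_op A" by (simp add: A effects_selfadj)
  have sT: "selfadj_op T" using f_solution_effect[OF A p T] by (rule effects_selfadj)
  define E where "E \<epsilon> = (1 - \<epsilon>) *\<^sub>R A + \<epsilon> *\<^sub>R id_blinfun" for \<epsilon>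
  define D where "D = f_denom p A"
  have main: "s * (cmod (cinner (f_denom p (E \<epsilon>) x) w))\<^sup>2 \<le> inner (E \<epsilon> (f_denom p (E \<epsilon>) w)) w"
    if "0 < \<epsilon>" "\<epsilon> \<le> 1" for \<epsilon> w
  proof -
    let ?D = "f_denom p (E \<epsilon>)"
    have form: "inner (E \<epsilon> z) z = inner (A z) z + \<epsilon> * ((norm z)\<^sup>2 - inner (A z) z)" for z
      by (simp add: E_def blinfun.bilinear_simps inner_add_left power2_norm_eq_inner algebra_simps)
    have sE: "selfadj_op (E \<epsilon>)" by (simp add: E_def selfadj_op_intros sA)
    have lE: "inner (A z) z \<le> inner (E \<epsilon> z) z" for z
      unfolding form using that effects_le_norm[OF A, of z] by simp
    have "inner (E \<epsilon> z) z \<le> (norm z)\<^sup>2" for z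
    proof -
      have "\<epsilon> * ((norm z)\<^sup>2 - inner (A z) z) \<le> 1 * ((norm z)\<^sup>2 - inner (A z) z)"
        using that effects_le_norm[OF A, of z] by (intro mult_right_mono) auto
      then show ?thesis unfolding form by simp
    qed
    then have E: "E \<epsilon> \<in> effects"
      using lE effects_nonneg[OF A] by (auto simp: effects_iff sE intro: order_trans)
    have "\<epsilon> * (norm z)\<^sup>2 \<le> inner (E \<epsilon> z) z" for z
    proof -
      have "0 \<le> (1 - \<epsilon>) * inner (A z) z" using that effects_nonneg[OF A] by simp
      then show ?thesis unfolding form by (simp add: algebra_simps)
    qed
    then obtain G where "E \<epsilon> o\<^sub>L G = id_blinfun"
      using coercive_bij[OF selfadj_op_clinear[OF sE] \<open>0 < \<epsilon>\<close>] by blast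
    then obtain y where y: "E \<epsilon> y = x"
      by (metis blinfun_apply_blinfun_compose id_blinfun.rep_eq)
    have "t *\<^sub>R rank_one x \<preceq> E \<epsilon>"
      using le lE unfolding scaled_rank_one_le_iff[OF sA] scaled_rank_one_le_iff[OF sE]
      by (meson order_trans)
    then have m: "t * inner y x \<le> 1"
      using strength_iff[OF sE effects_nonneg[OF E] y t(1)] by simp
    have S: "selfadj_op (E \<epsilon> o\<^sub>L ?D)"
    proof -
      have "E \<epsilon> o\<^sub>L ?D = p *\<^sub>R (E \<epsilon> o\<^sub>L E \<epsilon>) + (1 - p) *\<^sub>R E \<epsilon>"
        by (rule blinfun_eqI) (simp add: f_denom_apply blinfun.bilinear_simps)
      moreover have "selfadj_op (E \<epsilon> o\<^sub>L E \<epsilon>)"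
        using sE by (simp add: selfadj_op_def clinear_op_compose)
      ultimately show ?thesis by (simp add: selfadj_op_intros sE)
    qed
    have Sy: "(E \<epsilon> o\<^sub>L ?D) y = ?D x"
      by (simp add: f_denom_apply blinfun.bilinear_simps y)
    have Spos: "0 \<le> inner ((E \<epsilon> o\<^sub>L ?D) z) z" for z
      using effects_f_denom_nonneg[OF E p] by simp
    have "s * inner y (?D x) \<le> 1"
    proof -
      have "inner y (?D x) = p + (1 - p) * inner y x"
        using x selfadj_op_inner[OF sE, of y x]
        by (simp add: f_denom_apply inner_add_right y flip: power2_norm_eq_inner)
      then have "s * inner y (?D x) = t * (p + (1 - p) * inner y x) / (t * p + (1 - p))"
        by (simp only: s_def f_fun_def times_divide_eq_left)
      also have "t * (p + (1 - p) * inner y x) = t * p + (1 - p) * (t * inner y x)"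
        by (simp add: algebra_simps)
      also have "(t * p + (1 - p) * (t * inner y x)) / (t * p + (1 - p)) \<le> 1"
        using den p mult_left_mono[OF m, of "1 - p"] by simp
      finally show ?thesis .
    qed
    then have "s *\<^sub>R rank_one (?D x) \<preceq> E \<epsilon> o\<^sub>L ?D"
      using strength_iff[OF S Spos Sy \<open>s \<ge> 0\<close>] by blast
    then show ?thesis
      unfolding scaled_rank_one_le_iff[OF S] by (simp add: cmod_cinner_commute[of "?D x"])
  qed
  have lim: "s * (cmod (cinner (D x) w))\<^sup>2 \<le> inner (A (D w)) w" for w
  proof (rule tendsto_le[of "at_right 0"])
    have E: "(E \<longlongrightarrow> A) (at_right 0)"
      unfolding E_def by (auto intro!: tendsto_eq_intros)
    have fE: "((\<lambda>\<epsilon>. f_denom p (E \<epsilon>)) \<longlongrightarrow> D) (at_right 0)"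
      unfolding f_denom_def D_def by (intro tendsto_intros E)
    show "((\<lambda>\<epsilon>. inner (E \<epsilon> (f_denom p (E \<epsilon>) w)) w) \<longlongrightarrow> inner (A (D w)) w) (at_right 0)"
      by (intro tendsto_intros E fE)
    show "((\<lambda>\<epsilon>. s * (cmod (cinner (f_denom p (E \<epsilon>) x) w))\<^sup>2) \<longlongrightarrow> s * (cmod (cinner (D x) w))\<^sup>2)
        (at_right 0)"
      by (intro tendsto_intros bounded_linear.tendsto[OF bounded_linear_cinner_left] fE)
    show "\<forall>\<^sub>F \<epsilon> in at_right 0. s * (cmod (cinner (f_denom p (E \<epsilon>) x) w))\<^sup>2
        \<le> inner (E \<epsilon> (f_denom p (E \<epsilon>) w)) w"
      using eventually_at_right_real[OF zero_less_one]
      by (rule eventually_mono) (simp add: main)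
  qed simp
  obtain G where G: "D o\<^sub>L G = id_blinfun"
    unfolding D_def using f_denom_bij[OF A p] by blast
  have "s * (cmod (cinner z x))\<^sup>2 \<le> inner (T z) z" for z
  proof -
    define w where "w = G z"
    have z: "z = D w" using G by (metis blinfun_apply_blinfun_compose id_blinfun.rep_eq w_def)
    have sD: "selfadj_op D" by (simp add: D_def f_denom_def selfadj_op_intros sA)
    have "T z = A w"
      unfolding z using T by (metis D_def blinfun_apply_blinfun_compose)
    then have "inner (T z) z = inner (A (D w)) w"
      using z selfadj_op_inner[OF sA, of w "D w"] by (simp add: inner_commute)
    moreover have "cmod (cinner (D x) w) = cmod (cinner z x)"
      by (simp add: z selfadj_op_cinner[OF sD] cmod_cinner_commute[of x])
    ultimately show ?thesis
      using lim[of w] by simp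
  qed
  then show ?thesis
    by (simp add: scaled_rank_one_le_iff[OF sT] s_def)
qed

section \<open>Rigidity of the transition probability\<close>

definition transition :: "'a::complex_inner_space \<Rightarrow> 'a \<Rightarrow> real" where
  "transition x y = (cmod (cinner x y))\<^sup>2"

lemma transition_commute: "transition x y = transition y x"
  by (simp add: transition_def cmod_cinner_commute[of x])

lemma transition_nonneg [simp]: "0 \<le> transition x y"
  by (simp add: transition_def)

lemma transition_eq_0_iff: "transition x y = 0 \<longleftrightarrow> cinner x y = 0"
  by (simp add: transition_def)

lemma transition_le_1: "norm x = 1 \<Longrightarrow> norm y = 1 \<Longrightarrow> transition x y \<le> 1"
  using norm_cinner_le[of x y] by (simp add: transition_def power_le_one)

lemma orthonormal_combination:
  fixes x x' :: "'a::complex_inner_space"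
  assumes "norm x = 1" "norm x' = 1" "cinner x x' = 0" "a\<^sup>2 + b\<^sup>2 = 1"
  defines "y \<equiv> a *\<^sub>R x + b *\<^sub>R x'"
  shows "norm y = 1" "transition x y = a\<^sup>2" "transition x' y = b\<^sup>2"
proof -
  have x'x: "cinner x' x = 0"
    using assms(3) cinner_eq_0_commute by blast
  show "transition x y = a\<^sup>2" "transition x' y = b\<^sup>2"
    using assms(1-3) x'x by (simp_all add: transition_def y_def cinner_add_right cinner_self)
  have "cinner y y = complex_of_real (a\<^sup>2 + b\<^sup>2)"
    using assms(1-3) x'x unfolding y_def
    by (simp add: cinner_add_left cinner_add_right cinner_self[of x] cinner_self[of x'])
      (simp add: power2_eq_square)
  then have "(norm y)\<^sup>2 = 1"
    using assms(4) of_real_eq_iff unfolding cinner_self by metis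
  then show "norm y = 1"
    using norm_ge_zero[of y] by (auto simp: power2_eq_1_iff)
qed

text \<open>
  Monotonicity and \<open>F (u / 4) = F u / 4\<close> keep \<open>F u / u\<close> between two positive constants on
  \<open>(0, 1]\<close>, so that the powers of \<open>b / a\<close> are bounded above and bounded away from \<open>0\<close>.
\<close>

lemma scaling_factor_unique:
  fixes F :: "real \<Rightarrow> real"
  assumes mono: "\<And>u v. 0 \<le> u \<Longrightarrow> u \<le> v \<Longrightarrow> F u \<le> F v"
    and pos: "F 1 > 0"
    and quarter: "\<And>u. 0 \<le> u \<Longrightarrow> F (u / 4) = F u / 4"
    and scale: "\<And>u. 0 \<le> u \<Longrightarrow> F (a * u) = b * F u"
    and a: "0 < a" "a \<le> 1" and b: "b \<ge> 0"
  shows "b = a"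
proof -
  have bounds: "F 1 * u \<le> 4 * F u \<and> F u \<le> 4 * F 1 * u" if "(1/4) ^ n \<le> u" "u \<le> 1" for n u
    using that
  proof (induction n arbitrary: u)
    case 0
    then have "u = 1" by simp
    then show ?case using pos by simp
  next
    case (Suc n)
    show ?case
    proof (cases "u \<ge> 1/4")
      case True
      have "F 1 / 4 \<le> F u" "F u \<le> F 1"
        using quarter[of 1] mono[of "1/4" u] mono[of u 1] True Suc.prems by auto
      moreover have "F 1 * u \<le> F 1 * 1" "F 1 * 1 \<le> F 1 * (4 * u)"
        using pos True Suc.prems by (intro mult_left_mono; simp)+
      ultimately show ?thesis by simp
    next
      case False
      then have "F 1 * (4 * u) \<le> 4 * F (4 * u) \<and> F (4 * u) \<le> 4 * F 1 * (4 * u)"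
        using Suc.prems by (intro Suc.IH) auto
      moreover have "F u = F (4 * u) / 4"
        using quarter[of "4 * u"] order_trans[OF zero_le_power Suc.prems(1)] by simp
      ultimately show ?thesis by simp
    qed
  qed
  have power: "F (a ^ n) = b ^ n * F 1" for n
    by (induction n) (use scale a in auto)
  have "F 1 * a ^ n \<le> 4 * F (a ^ n) \<and> F (a ^ n) \<le> 4 * F 1 * a ^ n" for n
  proof -
    obtain m where "(1/4 :: real) ^ m < a ^ n"
      using real_arch_pow_inv[of "a ^ n" "1/4"] a by auto
    then show ?thesis
      using bounds[of m "a ^ n"] a by (simp add: power_le_one)
  qed
  then have "F 1 * a ^ n \<le> F 1 * (4 * b ^ n) \<and> F 1 * b ^ n \<le> F 1 * (4 * a ^ n)" for n
    unfolding power by (simp add: mult.commute mult.left_commute)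
  then have "a ^ n \<le> 4 * b ^ n \<and> b ^ n \<le> 4 * a ^ n" for n
    using pos by simp
  then have ratio: "1/4 \<le> (b / a) ^ n" "(b / a) ^ n \<le> 4" for n
    using a by (simp_all add: power_divide field_simps)
  show ?thesis
  proof (rule ccontr)
    assume "b \<noteq> a"
    then consider "b / a > 1" | "b / a < 1"
      using a by (metis divide_eq_1_iff less_irrefl linorder_neqE_linordered_idom)
    then show False
    proof cases
      case 1
      then show ?thesis using real_arch_pow[of "b / a" 4] ratio(2) by (metis not_less)
    next
      case 2
      then show ?thesis
        using real_arch_pow_inv[of "1/4" "b / a"] ratio(1) by (metis not_less zero_less_divide_1_iff zero_less_numeral)
    qed
  qed
qed

text \<open>
  The hypothesis \<open>eq\<close> is what the order structure says about a pair of rank one projections;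
  \<open>F x\<close> describes the action on the multiples of \<open>rank_one x\<close>. Applied twice, \<open>eq\<close> gives
  \<open>F x (c\<^sup>2 u) = c'\<^sup>2 F x u\<close> for the transition probabilities \<open>c\<close> of \<open>x, y\<close> and \<open>c'\<close> of
  \<open>g x, g y\<close>. If \<open>y\<close> is halfway between orthogonal vectors \<open>x\<close> and \<open>x'\<close>, then
  \<open>F y (1/4) = c'\<^sup>2 F y 1\<close> with the \<open>c'\<close> of either pair; so the two values agree, and as they add
  up to \<open>1\<close>, they are \<open>1/2\<close>. The other values are preserved by \<open>scaling_factor_unique\<close>.
\<close>

lemma transition_rigidity:
  fixes g :: "'a::complex_inner_space \<Rightarrow> 'a" and F :: "'a \<Rightarrow> real \<Rightarrow> real"
  assumes perp: "\<And>x :: 'a. norm x = 1 \<Longrightarrow> \<exists>x'. norm x' = 1 \<and> cinner x x' = 0"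
    and g: "\<And>x. norm x = 1 \<Longrightarrow> norm (g x) = 1"
    and surj: "\<And>y. norm y = 1 \<Longrightarrow> \<exists>x c. norm x = 1 \<and> y = c *\<^sub>C g x"
    and F0: "\<And>x. norm x = 1 \<Longrightarrow> F x 0 = 0"
    and Fpos: "\<And>x u. norm x = 1 \<Longrightarrow> 0 < u \<Longrightarrow> 0 < F x u"
    and mono: "\<And>x u v. norm x = 1 \<Longrightarrow> 0 \<le> u \<Longrightarrow> u \<le> v \<Longrightarrow> F x u \<le> F x v"
    and eq: "\<And>x y u. norm x = 1 \<Longrightarrow> norm y = 1 \<Longrightarrow> 0 \<le> u \<Longrightarrow>
      F y (transition x y * u) = transition (g x) (g y) * F x u"
    and e: "norm (e :: 'a) = 1"
  shows "\<And>x y. norm x = 1 \<Longrightarrow> norm y = 1 \<Longrightarrow> transition (g x) (g y) = transition x y"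
    and "\<And>x u. norm x = 1 \<Longrightarrow> 0 \<le> u \<Longrightarrow> F x u = F e 1 * u"
proof -
  have orth: "cinner (g x) (g y) = 0 \<longleftrightarrow> cinner x y = 0" if "norm x = 1" "norm y = 1" for x y
  proof -
    have "transition (g x) (g y) = 0 \<longleftrightarrow> transition x y = 0"
    proof
      assume "transition (g x) (g y) = 0"
      then have "F y (transition x y) = 0" using eq[OF that, of 1] by simp
      then show "transition x y = 0"
        using Fpos[OF that(2), of "transition x y"] transition_nonneg[of x y] by linarith
    next
      assume "transition x y = 0"
      then have "transition (g x) (g y) * F x 1 = 0" using eq[OF that, of 1] F0[OF that(2)] by simp
      then show "transition (g x) (g y) = 0" using Fpos[OF that(1), of 1] by simp
    qed
    then show ?thesis by (simp add: transition_eq_0_iff)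
  qed
  \<comment> \<open>A vector orthogonal to \<open>g x\<close> and \<open>g x'\<close> is, up to scaling, the image of one that is
    orthogonal to \<open>x\<close> and \<open>x'\<close>.\<close>
  have total: "transition (g x) (g (a *\<^sub>R x + b *\<^sub>R x')) + transition (g x') (g (a *\<^sub>R x + b *\<^sub>R x')) = 1"
    if x: "norm x = 1" and x': "norm x' = 1" and xx': "cinner x x' = 0" and ab: "a\<^sup>2 + b\<^sup>2 = 1"
    for x x' a b
  proof -
    define y where "y = a *\<^sub>R x + b *\<^sub>R x'"
    have y: "norm y = 1"
      unfolding y_def by (rule orthonormal_combination(1)[OF that])
    define w1 where "w1 = g y - cinner (g y) (g x) *\<^sub>C g x"
    define w where "w = w1 - cinner w1 (g x') *\<^sub>C g x'"
    have gxx': "cinner (g x) (g x') = 0" "cinner (g x') (g x) = 0"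
      using orth[OF x x'] xx' cinner_eq_0_commute by blast+
    have w1x: "cinner w1 (g x) = 0" unfolding w1_def by (rule cinner_residual(1)[OF g[OF x]])
    have wx: "cinner w (g x) = 0" by (simp add: w_def cinner_algebra w1x gxx')
    have wx': "cinner w (g x') = 0" unfolding w_def by (rule cinner_residual(1)[OF g[OF x']])
    have "w = 0"
    proof (rule ccontr)
      assume "w \<noteq> 0"
      then have "norm ((1 / norm w) *\<^sub>R w) = 1" by simp
      then obtain v c where v: "norm v = 1" and c: "(1 / norm w) *\<^sub>R w = c *\<^sub>C g v"
        using surj by blast
      have "c \<noteq> 0" using c \<open>w \<noteq> 0\<close> by auto
      have "w = norm w *\<^sub>R (1 / norm w) *\<^sub>R w" using \<open>w \<noteq> 0\<close> by simp
      then have w: "w = norm w *\<^sub>R c *\<^sub>C g v" by (simp only: c)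
      have gv: "cinner w z = complex_of_real (norm w) * c * cinner (g v) z" for z
        by (subst w) (simp add: cinner_scaleC_left)
      have "cinner v x = 0" "cinner v x' = 0"
        using wx wx' \<open>c \<noteq> 0\<close> \<open>w \<noteq> 0\<close> orth[OF v x] orth[OF v x'] by (simp_all add: gv)
      then have "cinner v y = 0" by (simp add: y_def cinner_add_right)
      then have "cinner w (g y) = 0" using orth[OF v y] by (simp add: gv)
      moreover have "cinner w (g y) = cinner w w"
        by (simp add: w_def[THEN arg_cong, of "cinner w"] w1_def[THEN arg_cong, of "cinner w"]
            cinner_diff_right cinner_scaleC_right wx wx')
      ultimately show False using \<open>w \<noteq> 0\<close> by (simp add: cinner_self)
    qed
    have "transition (g x) (g y) = (norm (g y))\<^sup>2 - (norm w1)\<^sup>2"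
      unfolding w1_def using cinner_residual(2)[OF g[OF x], of "g y"]
      by (simp add: transition_def cmod_cinner_commute)
    moreover have "(norm w1)\<^sup>2 = (cmod (cinner w1 (g x')))\<^sup>2"
      using cinner_residual(2)[OF g[OF x'], of w1] \<open>w = 0\<close> by (simp add: w_def)
    moreover have "cinner w1 (g x') = cinner (g y) (g x')"
      by (simp add: w1_def cinner_algebra gxx')
    ultimately show ?thesis
      using g[OF y] by (simp add: transition_def y_def cmod_cinner_commute[of "g x'"])
  qed
  have half: "transition (g x) (g y) = 1/2 \<and> norm y = 1 \<and> transition x y = 1/2"
    if x: "norm x = 1" and x': "norm x' = 1" and xx': "cinner x x' = 0"
      and y_def: "y = sqrt (1/2) *\<^sub>R x + sqrt (1/2) *\<^sub>R x'" for x x' y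
  proof -
    have "(sqrt (1/2))\<^sup>2 + (sqrt (1/2))\<^sup>2 = 1" by simp
    note ab = orthonormal_combination[OF x x' xx' this] total[OF x x' xx' this]
    then have y: "norm y = 1" "transition x y = 1/2" "transition x' y = 1/2"
      "transition (g x) (g y) + transition (g x') (g y) = 1"
      by (simp_all add: y_def)
    have sq: "F y (1/4) = (transition (g z) (g y))\<^sup>2 * F y 1"
      if z: "norm z = 1" "transition z y = 1/2" for z
    proof -
      have "F y (1/4) = transition (g z) (g y) * F z (1/2)"
        using eq[OF z(1) y(1), of "1/2"] z(2) by simp
      also have "F z (1/2) = transition (g y) (g z) * F y 1"
        using eq[OF y(1) z(1), of 1] z(2) by (simp add: transition_commute[of y z])
      finally show ?thesis by (simp add: power2_eq_square transition_commute[of "g y"])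
    qed
    have "(transition (g x) (g y))\<^sup>2 = (transition (g x') (g y))\<^sup>2"
      using sq[OF x y(2)] sq[OF x' y(3)] Fpos[OF y(1), of 1] by simp
    then have "transition (g x) (g y) = transition (g x') (g y)"
      by (simp add: power2_eq_iff_nonneg)
    then show ?thesis using y by simp
  qed
  have twice: "F x (transition x y * transition x y * u)
      = transition (g x) (g y) * transition (g x) (g y) * F x u"
    if "norm x = 1" "norm y = 1" "0 \<le> u" for x y u
    using eq[OF that(2,1), of "transition x y * u"] eq[OF that] that(3)
    by (simp add: transition_commute mult.assoc)
  have quarter: "F x (u / 4) = F x u / 4" if x: "norm x = 1" and "0 \<le> u" for x u
  proof -
    obtain x' where "norm x' = 1" "cinner x x' = 0" using perp[OF x] by blast
    then obtain y where y: "norm y = 1" "transition (g x) (g y) = 1/2" "transition x y = 1/2"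
      using half[OF x] by blast
    show ?thesis using twice[OF x y(1) \<open>0 \<le> u\<close>] unfolding y(2,3) by simp
  qed
  show trans: "transition (g x) (g y) = transition x y" if x: "norm x = 1" and y: "norm y = 1" for x y
  proof (cases "transition x y = 0")
    case True
    then show ?thesis using orth[OF x y] transition_eq_0_iff by metis
  next
    case False
    then have c: "0 < transition x y" using transition_nonneg[of x y] by linarith
    have "transition (g x) (g y) * transition (g x) (g y) = transition x y * transition x y"
    proof (rule scaling_factor_unique[of "F x"])
      show "transition x y * transition x y \<le> 1"
        using transition_le_1[OF x y] by (simp add: mult_le_one)
    qed (use mono[OF x] Fpos[OF x] quarter[OF x] twice[OF x y] c in auto)
    then show ?thesis
      by (metis power2_eq_iff_nonneg power2_eq_square transition_nonneg)
  qed
  have homog: "F x (s * u) = s * F x u" if x: "norm x = 1" and s: "0 \<le> s" "s \<le> 1" and u: "0 \<le> u" for x s u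
  proof -
    obtain x' where x': "norm x' = 1" "cinner x x' = 0" using perp[OF x] by blast
    define a where "a = sqrt (sqrt s)"
    define b where "b = sqrt (1 - sqrt s)"
    have "a\<^sup>2 + b\<^sup>2 = 1" using s by (simp add: a_def b_def)
    then obtain y where y: "norm y = 1" "transition x y = sqrt s"
      using orthonormal_combination[OF x x'] s by (metis a_def real_sqrt_ge_zero real_sqrt_pow2)
    show ?thesis
      using twice[OF x y(1) u] trans[OF x y(1)] y(2) s by simp
  qed
  have linear: "F x u = F x 1 * u" if x: "norm x = 1" and u: "0 \<le> u" for x u
  proof (cases "u \<le> 1")
    case True
    then show ?thesis using homog[OF x u True, of 1] by simp
  next
    case False
    then show ?thesis using homog[OF x _ _ u, of "1 / u"] by (simp add: field_simps)
  qed
  have same: "F x 1 = F y 1" if "norm x = 1" "norm y = 1" "cinner x y \<noteq> 0" for x y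
    using eq[OF that(1,2), of 1] trans[OF that(1,2)] linear[OF that(2), of "transition x y"] that(3)
    by (simp add: transition_eq_0_iff[symmetric])
  show "F x u = F e 1 * u" if x: "norm x = 1" and u: "0 \<le> u" for x u
  proof -
    have "F x 1 = F e 1"
    proof (cases "cinner x e = 0")
      case False
      then show ?thesis by (rule same[OF x e])
    next
      case True
      define y where "y = sqrt (1/2) *\<^sub>R x + sqrt (1/2) *\<^sub>R e"
      have y: "norm y = 1" "transition x y = 1/2"
        using half[OF x e True y_def] by auto
      have "transition e y = 1/2"
        using orthonormal_combination(3)[OF x e True, of "sqrt (1/2)" "sqrt (1/2)"] by (simp add: y_def)
      then have "cinner x y \<noteq> 0" "cinner y e \<noteq> 0"
        using y(2) transition_eq_0_iff[of x y] transition_eq_0_iff[of e y] cinner_eq_0_commute[of y e]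
        by auto
      then show ?thesis using same[OF x y(1)] same[OF y(1) e] by simp
    qed
    then show ?thesis using linear[OF x u] by simp
  qed
qed

section \<open>Wigner's theorem\<close>

lemma cinner_eq_Complex: "cinner x y = Complex (inner x y) (inner x (\<i> *\<^sub>C y))"
  for x :: "'a::complex_inner_space"
  by (simp add: complex_eq_iff inner_eq_Re_cinner cinner_scaleC_right)

lemma cinner_extensional: "(\<And>x. cinner x y = cinner x z) \<Longrightarrow> y = z"
  for y :: "'a::complex_inner_space"
  by (metis cinner_diff_right cinner_self eq_iff_diff_eq_0 norm_eq_zero of_real_eq_0_iff
      zero_eq_power2)

lemma Cauchy_Schwarz_equality:
  fixes x y :: "'a::complex_inner_space"
  assumes "cmod (cinner x y) = norm x * norm y" "norm x = norm y"
  obtains c where "cmod c = 1" "x = c *\<^sub>C y" "cinner x y = c * complex_of_real ((norm y)\<^sup>2)"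
proof (cases "y = 0")
  case True
  then show thesis using that[of 1] assms by simp
next
  case False
  define u where "u = (1 / norm y) *\<^sub>R y"
  have u: "norm u = 1" using False by (simp add: u_def)
  have xu: "cinner x u = cinner x y / complex_of_real (norm y)"
    by (simp add: u_def)
  have "cmod (cinner x u) = norm x"
    using False assms(1) by (simp add: xu norm_divide)
  then have x: "x = cinner x u *\<^sub>C u" by (rule norm_cinner_eq_unit[OF u])
  define c where "c = cinner x u / complex_of_real (norm y)"
  have "cmod c = 1"
    using False assms by (simp add: c_def xu norm_divide norm_mult)
  moreover have "x = c *\<^sub>C y"
  proof -
    have "cinner x u *\<^sub>C u = cinner x u *\<^sub>C complex_of_real (1 / norm y) *\<^sub>C y"
      by (simp only: u_def scaleC_of_real)
    also have "\<dots> = c *\<^sub>C y"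
      by (simp add: c_def)
    finally show ?thesis by (rule trans[OF x])
  qed
  moreover from this have "cinner x y = c * complex_of_real ((norm y)\<^sup>2)"
    by (simp add: cinner_scaleC_left cinner_self)
  ultimately show thesis by (rule that)
qed

text \<open>
  The map \<open>\<kappa>\<close> tells the linear from the conjugate-linear case. Norms determine the real parts of
  inner products by polarization, and replacing \<open>y\<close> by \<open>i y\<close> yields the imaginary parts, with the
  sign given by \<open>\<kappa> i\<close>. The inverse is then an adjoint in the sense that belongs to \<open>\<kappa>\<close>.
\<close>

lemma isometry_unitary_or_antiunitary:
  fixes f :: "'a::complex_hilbert_space \<Rightarrow> 'a"
  assumes add: "\<And>x y. f (x + y) = f x + f y"
    and hom: "\<And>c x. f (c *\<^sub>C x) = \<kappa> c *\<^sub>C f x"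
    and \<kappa>: "\<kappa> = (\<lambda>c. c) \<or> \<kappa> = cnj"
    and norm: "\<And>x. norm (f x) = norm x"
    and surj: "surj f"
  obtains U :: "'a \<Rightarrow>\<^sub>L 'a" where "unitary_op U \<or> antiunitary_op U" "\<And>x. U x = f x"
    "\<And>x. f (adj_op U x) = x" "\<And>x. adj_op U (f x) = x"
    "\<And>x y. cinner (f x) (f y) = \<kappa> (cinner x y)"
proof -
  have scaleR: "f (r *\<^sub>R x) = r *\<^sub>R f x" for r x
    using hom[of "complex_of_real r" x] \<kappa> by (auto simp: scaleC_of_real)
  have bl: "bounded_linear f"
    by (rule bounded_linear_intro[of _ 1]) (simp_all add: add scaleR norm)
  then interpret f: bounded_linear f .
  have "inj f"
    by (metis (no_types, lifting) f.diff injI norm norm_eq_zero right_minus_eq)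
  define h where "h = inv f"
  have fh: "f (h x) = x" for x using surj by (simp add: h_def surj_f_inv_f)
  have hf: "h (f x) = x" for x using \<open>inj f\<close> by (simp add: h_def)
  have blh: "bounded_linear h"
  proof (rule bounded_linear_intro[of _ 1])
    show "h (x + y) = h x + h y" for x y by (metis add fh hf)
    show "h (r *\<^sub>R x) = r *\<^sub>R h x" for r x by (metis scaleR fh hf)
    show "norm (h x) \<le> norm x * 1" for x by (metis fh norm mult.right_neutral order_refl)
  qed
  define U where "U = Blinfun f"
  define V where "V = Blinfun h"
  have U: "U x = f x" for x by (simp add: U_def bounded_linear_Blinfun_apply bl)
  have V: "V x = h x" for x by (simp add: V_def bounded_linear_Blinfun_apply blh)
  have inner: "inner (f x) (f y) = inner x y" for x y
  proof -
    have "(norm (f x + f y))\<^sup>2 = (norm (x + y))\<^sup>2" by (simp add: norm flip: add)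
    moreover have "(norm (f x))\<^sup>2 = (norm x)\<^sup>2" "(norm (f y))\<^sup>2 = (norm y)\<^sup>2"
      by (simp_all add: norm)
    ultimately show ?thesis
      by (simp add: power2_norm_eq_inner inner_add_left inner_add_right inner_commute)
  qed
  have cinner: "cinner (f x) (f y) = \<kappa> (cinner x y)" for x y
    using \<kappa>
  proof
    assume "\<kappa> = (\<lambda>c. c)"
    then show ?thesis
      using inner[of x y] inner[of x "\<i> *\<^sub>C y"] by (simp add: cinner_eq_Complex hom)
  next
    assume "\<kappa> = cnj"
    then show ?thesis
      using inner[of x y] inner[of x "\<i> *\<^sub>C y"]
      by (simp add: complex_eq_iff cinner_eq_Complex hom cspace.scale_minus_left)
  qed
  have cinner_h: "cinner (f x) y = \<kappa> (cinner x (h y))" for x y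
    using cinner[of x "h y"] by (simp add: fh)
  have lin: "\<kappa> = (\<lambda>c. c) \<Longrightarrow> clinear_op U" and anti: "\<kappa> = cnj \<Longrightarrow> antilinear_op U"
    by (simp_all add: clinear_op_def antilinear_op_def U hom)
  have adj: "adj_op U = V"
    unfolding adj_op_def
  proof (rule the_equality)
    show "is_adjoint U V"
      using \<kappa> lin anti by (auto simp: is_adjoint_def U V cinner_h)
  next
    fix B assume B: "is_adjoint U B"
    show "B = V"
    proof (cases "clinear_op U \<and> antilinear_op U")
      case True
      have "x = 0" for x :: 'a
      proof -
        have "\<i> *\<^sub>C f x = cnj \<i> *\<^sub>C f x"
          using True unfolding clinear_op_def antilinear_op_def U by metis
        then have "2 *\<^sub>R \<i> *\<^sub>C f x = 0"
          by (simp add: scaleR_2 cspace.scale_minus_left eq_neg_iff_add_eq_0)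
        then have "\<i> *\<^sub>C f x = 0" by simp
        then show ?thesis by (metis norm norm_scaleC norm_eq_zero norm_ii mult_1)
      qed
      then show ?thesis by (metis blinfun_eqI)
    next
      case False
      then have "cinner x (B y) = cinner x (h y)" for x y
        using \<kappa> lin anti B by (auto simp: is_adjoint_def U cinner_h)
      then show ?thesis
        by (intro blinfun_eqI cinner_extensional) (simp add: V)
    qed
  qed
  have "adj_op U o\<^sub>L U = id_blinfun" "U o\<^sub>L adj_op U = id_blinfun"
    by (auto intro!: blinfun_eqI simp: adj U V fh hf)
  then have "unitary_op U \<or> antiunitary_op U"
    using \<kappa> lin anti by (auto simp: unitary_op_def antiunitary_op_def)
  then show thesis
    by (rule that) (simp_all add: adj U V fh hf cinner)
qed

text \<open>
  Bargmann's proof. Fix a unit vector \<open>e\<close>. The ray of \<open>e + z\<close>, with \<open>z\<close> orthogonal to \<open>e\<close>, is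
  mapped to the ray of \<open>g e + V z\<close> for a unique \<open>V z\<close> orthogonal to \<open>g e\<close>. As \<open>V\<close> preserves both
  \<open>\<bar>\<langle>z, w\<rangle>\<bar>\<close> and \<open>\<bar>1 + \<langle>z, w\<rangle>\<bar>\<close>, it preserves \<open>Re \<langle>z, w\<rangle>\<close>; hence it is real linear. For every
  \<open>z\<close>, \<open>V (i z)\<close> is \<open>i V z\<close> or \<open>- i V z\<close>. These alternatives define two real subspaces that cover
  the orthogonal complement of \<open>e\<close>, so one of them is everything.
\<close>

theorem Wigner:
  fixes g :: "'a::complex_hilbert_space \<Rightarrow> 'a"
  assumes g: "\<And>x. norm x = 1 \<Longrightarrow> norm (g x) = 1"
    and trans: "\<And>x y. norm x = 1 \<Longrightarrow> norm y = 1 \<Longrightarrow> cmod (cinner (g x) (g y)) = cmod (cinner x y)"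
    and surj: "\<And>y. norm y = 1 \<Longrightarrow> \<exists>x c. norm x = 1 \<and> y = c *\<^sub>C g x"
    and e: "norm (e :: 'a) = 1"
  obtains U :: "'a \<Rightarrow>\<^sub>L 'a" and \<kappa> :: "complex \<Rightarrow> complex"
    where "unitary_op U \<or> antiunitary_op U"
      "\<And>x. norm x = 1 \<Longrightarrow> rank_one (U x) = rank_one (g x)"
      "\<And>x. U (adj_op U x) = x" "\<And>x. adj_op U (U x) = x"
      "\<kappa> = (\<lambda>c. c) \<or> \<kappa> = cnj" "\<And>c x. U (c *\<^sub>C x) = \<kappa> c *\<^sub>C U x"
      "\<And>x y. cinner (U x) (U y) = \<kappa> (cinner x y)"
proof -
  define G where "G x = norm x *\<^sub>R g ((1 / norm x) *\<^sub>R x)" for x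
  have norm_G: "norm (G x) = norm x" for x
    by (cases "x = 0") (simp_all add: G_def g)
  have G_unit: "G x = g x" if "norm x = 1" for x
    using that by (simp add: G_def)
  have G: "cmod (cinner (G x) (G y)) = cmod (cinner x y)" for x y
  proof (cases "x = 0 \<or> y = 0")
    case True
    then show ?thesis by (auto simp: G_def)
  next
    case False
    then show ?thesis
      using trans[of "(1 / norm x) *\<^sub>R x" "(1 / norm y) *\<^sub>R y"] by (simp add: G_def norm_mult norm_divide)
  qed
  define e' where "e' = g e"
  have e': "norm e' = 1" by (simp add: e'_def g e)
  have Ge: "G e = e'" by (simp add: G_unit e e'_def)
  define W where "W z = cnj (cinner (G (e + z)) e') *\<^sub>C G (e + z)" for z
  define V where "V z = W z - e'" for z
  have phase: "cmod (cinner (G (e + z)) e') = 1" if "cinner z e = 0" for z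
    using G[of "e + z" e] that e by (simp add: Ge cinner_add_left cinner_self)
  have V_perp: "cinner (V z) e' = 0" "cinner e' (V z) = 0" if "cinner z e = 0" for z
  proof -
    show "cinner (V z) e' = 0"
      using phase[OF that] mult_cnj[of "cinner (G (e + z)) e'"] e'
      by (simp add: V_def W_def cinner_algebra cinner_self mult.commute)
    then show "cinner e' (V z) = 0" using cinner_eq_0_commute by blast
  qed
  have W: "cmod (cinner (W z) (W w)) = cmod (1 + cinner z w)"
    if "cinner z e = 0" "cinner w e = 0" for z w
  proof -
    have "cmod (cinner (W z) (W w)) = cmod (cinner (G (e + z)) (G (e + w)))"
      using phase[OF that(1)] phase[OF that(2)]
      by (simp add: W_def cinner_scaleC_left cinner_scaleC_right norm_mult)
    also have "\<dots> = cmod (cinner (e + z) (e + w))"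
      by (rule G)
    also have "cinner (e + z) (e + w) = 1 + cinner z w"
      using that e cinner_eq_0_commute[of w e] by (simp add: cinner_algebra cinner_self)
    finally show ?thesis .
  qed
  have WV: "cinner (W z) (W w) = 1 + cinner (V z) (V w)"
    if "cinner z e = 0" "cinner w e = 0" for z w
  proof -
    have "W z = e' + V z" "W w = e' + V w" by (simp_all add: V_def)
    then show ?thesis using V_perp that e' by (simp add: cinner_algebra cinner_self)
  qed
  have norm_V: "norm (V z) = norm z" if "cinner z e = 0" for z
  proof -
    have "cmod (complex_of_real (1 + (norm (V z))\<^sup>2)) = cmod (complex_of_real (1 + (norm z)\<^sup>2))"
      using W[OF that that] WV[OF that that] by (simp add: cinner_self)
    then have "(norm (V z))\<^sup>2 = (norm z)\<^sup>2"
      by (simp only: norm_of_real) simp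
    then show ?thesis by (simp add: power2_eq_iff_nonneg)
  qed
  have V_ray: "\<exists>c. cmod c = 1 \<and> V z = c *\<^sub>C G z" if z: "cinner z e = 0" for z
  proof -
    have "cinner e' (G z) = 0"
      using G[of e z] z cinner_eq_0_commute[of z e] by (simp add: Ge)
    then have "cinner (V z) (G z) = cinner (W z) (G z)"
      by (simp add: V_def cinner_diff_left)
    then have "cmod (cinner (V z) (G z)) = cmod (cinner (G (e + z)) (G z))"
      using phase[OF z] by (simp add: W_def cinner_scaleC_left norm_mult)
    also have "\<dots> = cmod (cinner z z)"
      using z cinner_eq_0_commute[of z e] by (simp add: G cinner_add_left)
    also have "\<dots> = norm (V z) * norm (G z)"
      by (simp add: cinner_self norm_V[OF z] norm_G power2_eq_square norm_mult)
    finally show ?thesis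
      using Cauchy_Schwarz_equality[of "V z" "G z"] norm_V[OF z] norm_G by metis
  qed
  have cmod_V: "cmod (cinner (V z) (V w)) = cmod (cinner z w)"
    if z: "cinner z e = 0" and w: "cinner w e = 0" for z w
  proof -
    obtain c d where "cmod c = 1" "V z = c *\<^sub>C G z" "cmod d = 1" "V w = d *\<^sub>C G w"
      using V_ray[OF z] V_ray[OF w] by blast
    then show ?thesis by (simp add: cinner_algebra norm_mult G)
  qed
  have inner_V: "inner (V z) (V w) = inner z w" if z: "cinner z e = 0" and w: "cinner w e = 0" for z w
  proof -
    have "(cmod (1 + a))\<^sup>2 = 1 + 2 * Re a + (cmod a)\<^sup>2" for a
      by (simp add: cmod_power2) (simp add: power2_eq_square algebra_simps)
    then show ?thesis
      using W[OF z w] WV[OF z w] cmod_V[OF z w] unfolding inner_eq_Re_cinner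
      by (metis add_right_cancel add_left_cancel mult_left_cancel zero_neq_numeral)
  qed
  have perp_add: "cinner (z + w) e = 0" if "cinner z e = 0" "cinner w e = 0" for z w
    using that by (simp add: cinner_add_left)
  have perp_C: "cinner (c *\<^sub>C z) e = 0" if "cinner z e = 0" for c z
    using that by (simp add: cinner_scaleC_left)
  have perp_R: "cinner (r *\<^sub>R z) e = 0" if "cinner z e = 0" for r z
    using that by simp
  have V_add: "V (z + w) = V z + V w" if z: "cinner z e = 0" and w: "cinner w e = 0" for z w
  proof -
    have "inner (V (z + w) - (V z + V w)) (V (z + w) - (V z + V w)) = 0"
      using inner_V z w perp_add[OF z w]
      by (simp add: inner_diff_left inner_diff_right inner_add_left inner_add_right)
    then show ?thesis by simp
  qed
  have V_scaleR: "V (r *\<^sub>R z) = r *\<^sub>R V z" if z: "cinner z e = 0" for r z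
  proof -
    have "inner (V (r *\<^sub>R z) - r *\<^sub>R V z) (V (r *\<^sub>R z) - r *\<^sub>R V z) = 0"
      using inner_V z perp_R[OF z, of r]
      by (simp add: inner_diff_left inner_diff_right)
    then show ?thesis by simp
  qed
  have V_i: "V (\<i> *\<^sub>C z) = \<i> *\<^sub>C V z \<or> V (\<i> *\<^sub>C z) = - (\<i> *\<^sub>C V z)" if z: "cinner z e = 0" for z
  proof -
    note iz = perp_C[OF z, of \<i>]
    have "cmod (cinner (V (\<i> *\<^sub>C z)) (V z)) = norm (V (\<i> *\<^sub>C z)) * norm (V z)"
      by (simp add: cmod_V[OF iz z] norm_V iz z cinner_scaleC_left norm_mult cinner_self power2_eq_square)
    moreover have "norm (V (\<i> *\<^sub>C z)) = norm (V z)"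
      by (simp add: norm_V iz z)
    ultimately obtain c where c: "cmod c = 1" "V (\<i> *\<^sub>C z) = c *\<^sub>C V z"
      "cinner (V (\<i> *\<^sub>C z)) (V z) = c * complex_of_real ((norm (V z))\<^sup>2)"
      by (rule Cauchy_Schwarz_equality)
    have "inner (V (\<i> *\<^sub>C z)) (V z) = inner (\<i> *\<^sub>C z) z" by (rule inner_V[OF iz z])
    also have "\<dots> = 0" by (simp add: inner_eq_Re_cinner cinner_scaleC_left cinner_self flip: of_real_power)
    finally have *: "Re c * (norm (V z))\<^sup>2 = 0" by (simp add: inner_eq_Re_cinner c(3) flip: of_real_power)
    show ?thesis
    proof (cases "V z = 0")
      case True
      then show ?thesis using c(2) by simp
    next
      case False
      then have "Re c = 0" using * by simp
      then have "c = \<i> \<or> c = - \<i>"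
        using c(1) by (auto simp: complex_eq_iff cmod_def abs_if split: if_splits)
      then show ?thesis using c(2) by (auto simp: cspace.scale_minus_left)
    qed
  qed
  have "(\<forall>z. cinner z e = 0 \<longrightarrow> V (\<i> *\<^sub>C z) = \<i> *\<^sub>C V z)
      \<or> (\<forall>z. cinner z e = 0 \<longrightarrow> V (\<i> *\<^sub>C z) = - (\<i> *\<^sub>C V z))"
  proof (rule ccontr)
    assume "\<not> ?thesis"
    then obtain z w where z: "cinner z e = 0" "V (\<i> *\<^sub>C z) \<noteq> \<i> *\<^sub>C V z"
      and w: "cinner w e = 0" "V (\<i> *\<^sub>C w) \<noteq> - (\<i> *\<^sub>C V w)" by blast
    have z': "V (\<i> *\<^sub>C z) = - (\<i> *\<^sub>C V z)" and w': "V (\<i> *\<^sub>C w) = \<i> *\<^sub>C V w"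
      using V_i z w by blast+
    have "V (\<i> *\<^sub>C (z + w)) = - (\<i> *\<^sub>C V z) + \<i> *\<^sub>C V w"
      by (simp add: scaleC_add_right V_add perp_C z(1) w(1) z' w')
    moreover have "V (\<i> *\<^sub>C (z + w)) = \<i> *\<^sub>C V z + \<i> *\<^sub>C V w
        \<or> V (\<i> *\<^sub>C (z + w)) = - (\<i> *\<^sub>C V z) - \<i> *\<^sub>C V w"
      using V_i[OF perp_add[OF z(1) w(1)]] by (simp add: V_add z(1) w(1) scaleC_add_right)
    ultimately have "- (\<i> *\<^sub>C V z) = \<i> *\<^sub>C V z \<or> \<i> *\<^sub>C V w = - (\<i> *\<^sub>C V w)"
      by auto
    then show False using z(2) w(2) z' w' by auto
  qed
  then obtain \<kappa> :: "complex \<Rightarrow> complex" where \<kappa>: "\<kappa> = (\<lambda>c. c) \<or> \<kappa> = cnj"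
    and V_\<kappa>: "\<And>z. cinner z e = 0 \<Longrightarrow> V (\<i> *\<^sub>C z) = \<kappa> \<i> *\<^sub>C V z"
  proof
    assume "\<forall>z. cinner z e = 0 \<longrightarrow> V (\<i> *\<^sub>C z) = \<i> *\<^sub>C V z"
    then show thesis using that[of "\<lambda>c. c"] by simp
  next
    assume "\<forall>z. cinner z e = 0 \<longrightarrow> V (\<i> *\<^sub>C z) = - (\<i> *\<^sub>C V z)"
    then show thesis using that[of cnj] by (simp add: cspace.scale_minus_left)
  qed
  have \<kappa>_add: "\<kappa> (a + b) = \<kappa> a + \<kappa> b" and \<kappa>_mult: "\<kappa> (a * b) = \<kappa> a * \<kappa> b"
    and \<kappa>_cmod: "cmod (\<kappa> a) = cmod a" and \<kappa>_real: "\<kappa> (complex_of_real r) = complex_of_real r"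
    and \<kappa>_\<kappa>: "\<kappa> (\<kappa> a) = a" for a b r
    using \<kappa> by auto
  have V_scaleC: "V (c *\<^sub>C z) = \<kappa> c *\<^sub>C V z" if z: "cinner z e = 0" for c z
  proof -
    have split: "d *\<^sub>C v = Re d *\<^sub>R v + Im d *\<^sub>R \<i> *\<^sub>C v" for d and v :: 'a
      by (subst complex_eq[of d])
        (simp only: scaleC_add_left scaleC_of_real[symmetric] scaleC_scaleC mult.commute)
    have "V (c *\<^sub>C z) = Re c *\<^sub>R V z + Im c *\<^sub>R \<kappa> \<i> *\<^sub>C V z"
      unfolding split[of c z] by (simp add: V_add V_scaleR V_\<kappa> perp_R perp_C z)
    also have "\<dots> = \<kappa> c *\<^sub>C V z"
      using \<kappa> by (auto simp: split[of c] split[of "cnj c"] cspace.scale_minus_left)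
    finally show ?thesis .
  qed
  define P where "P x = x - cinner x e *\<^sub>C e" for x
  have P: "cinner (P x) e = 0" for x
    unfolding P_def by (rule cinner_residual(1)[OF e])
  define f where "f x = \<kappa> (cinner x e) *\<^sub>C e' + V (P x)" for x
  have f_add: "f (x + y) = f x + f y" for x y
  proof -
    have "P (x + y) = P x + P y"
      by (simp add: P_def cinner_add_left scaleC_add_left)
    then show ?thesis by (simp add: f_def V_add P cinner_add_left \<kappa>_add scaleC_add_left)
  qed
  have f_scaleC: "f (c *\<^sub>C x) = \<kappa> c *\<^sub>C f x" for c x
  proof -
    have "P (c *\<^sub>C x) = c *\<^sub>C P x"
      by (simp add: P_def cinner_scaleC_left cspace.scale_right_diff_distrib)
    then show ?thesis by (simp add: f_def V_scaleC P cinner_scaleC_left \<kappa>_mult scaleC_add_right)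
  qed
  have norm_f: "norm (f x) = norm x" for x
  proof -
    have "inner (\<kappa> (cinner x e) *\<^sub>C e') (V (P x)) = 0"
      by (simp add: inner_eq_Re_cinner cinner_scaleC_left V_perp P)
    then have "(norm (f x))\<^sup>2 = (norm (\<kappa> (cinner x e) *\<^sub>C e'))\<^sup>2 + (norm (V (P x)))\<^sup>2"
      unfolding f_def by (intro norm_add_Pythagorean) (simp add: orthogonal_def)
    also have "\<dots> = (norm x)\<^sup>2"
      using cinner_residual(2)[OF e, of x] by (simp add: norm_V P \<kappa>_cmod e' P_def[symmetric])
    finally show ?thesis by (simp add: power2_eq_iff_nonneg)
  qed
  have f_ray: "\<exists>c. cmod c = 1 \<and> f x = c *\<^sub>C G x" for x
  proof (cases "cinner x e = 0")
    case True
    then have "f x = V x" using \<kappa>_real[of 0] by (simp add: f_def P_def)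
    then show ?thesis using V_ray[OF True] by simp
  next
    case False
    define l where "l = cinner x e"
    define z where "z = (1 / l) *\<^sub>C P x"
    have l: "l \<noteq> 0" using False by (simp add: l_def)
    have z: "cinner z e = 0" by (simp add: z_def perp_C P)
    have Px: "P x = l *\<^sub>C z" using l by (simp add: z_def scaleC_one)
    have x: "x = l *\<^sub>C (e + z)"
      by (simp add: scaleC_add_right Px[symmetric]) (simp add: P_def l_def)
    have "f x = \<kappa> l *\<^sub>C W z"
      unfolding f_def Px V_scaleC[OF z] l_def[symmetric] by (simp add: V_def cspace.scale_right_diff_distrib)
    then have fx: "f x = (\<kappa> l * cnj (cinner (G (e + z)) e')) *\<^sub>C G (e + z)"
      by (simp add: W_def)
    have "cmod (cinner (f x) (G x)) = cmod l * cmod (cinner (G (e + z)) (G x))"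
      unfolding fx by (simp add: cinner_scaleC_left norm_mult \<kappa>_cmod phase[OF z])
    also have "\<dots> = cmod l * cmod (cinner (e + z) x)"
      by (simp add: G)
    also have "\<dots> = cmod (cinner (l *\<^sub>C (e + z)) x)"
      by (simp add: cinner_scaleC_left norm_mult)
    also have "\<dots> = cmod (cinner x x)"
      using x by (rule arg_cong[OF sym, of _ _ "\<lambda>v. cmod (cinner v x)"])
    also have "\<dots> = norm (f x) * norm (G x)"
      by (simp add: cinner_self norm_f norm_G power2_eq_square norm_mult)
    finally show ?thesis
      using Cauchy_Schwarz_equality[of "f x" "G x"] norm_f norm_G by metis
  qed
  have "surj f"
    unfolding surj_def
  proof
    fix y
    show "\<exists>x. y = f x"
    proof (cases "y = 0")
      case True
      then show ?thesis using norm_f[of 0] by (metis norm_eq_zero norm_zero)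
    next
      case False
      define u where "u = (1 / norm y) *\<^sub>R y"
      have u: "norm u = 1" using False by (simp add: u_def)
      obtain x c where x: "norm x = 1" and ux: "u = c *\<^sub>C g x" using surj[OF u] by blast
      obtain d where d: "cmod d = 1" "f x = d *\<^sub>C g x"
        using f_ray[of x] x by (auto simp: G_unit)
      then have "d \<noteq> 0" by auto
      define a where "a = complex_of_real (norm y) * c / d"
      have "f (\<kappa> a *\<^sub>C x) = (a * d) *\<^sub>C g x"
        by (simp add: f_scaleC \<kappa>_\<kappa> d(2))
      also have "a * d = complex_of_real (norm y) * c"
        using \<open>d \<noteq> 0\<close> by (simp add: a_def)
      also have "(complex_of_real (norm y) * c) *\<^sub>C g x = norm y *\<^sub>R u"
        by (simp only: ux scaleC_of_real[symmetric] scaleC_scaleC)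
      also have "\<dots> = y" using False by (simp add: u_def)
      finally show ?thesis by (metis)
    qed
  qed
  then obtain U :: "'a \<Rightarrow>\<^sub>L 'a" where U: "unitary_op U \<or> antiunitary_op U" "\<And>x. U x = f x"
    "\<And>x. f (adj_op U x) = x" "\<And>x. adj_op U (f x) = x"
    "\<And>x y. cinner (f x) (f y) = \<kappa> (cinner x y)"
    using isometry_unitary_or_antiunitary[of f \<kappa>] f_add f_scaleC \<kappa> norm_f by metis
  show thesis
  proof (rule that[OF U(1)])
    fix x :: 'a assume x: "norm x = 1"
    obtain c where "cmod c = 1" "f x = c *\<^sub>C g x"
      using f_ray[of x] x by (auto simp: G_unit)
    then show "rank_one (U x) = rank_one (g x)"
      by (simp add: U(2) rank_one_phase)
  qed (simp_all add: U f_scaleC \<kappa>)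
qed

section \<open>Order automorphisms that preserve zero products\<close>

lemma f_fun_inverse:
  assumes p: "p < 1" and t: "0 \<le> t" "t \<le> 1"
  shows "f_fun (- p / (1 - p)) (f_fun p t) = t"
proof -
  define d where "d = t * p + (1 - p)"
  have d: "d > 0" unfolding d_def by (rule f_fun_denom_pos(2)[OF p t])
  have q: "1 - - p / (1 - p) = 1 / (1 - p)" using p by (simp add: field_simps)
  have "t / d * (- p / (1 - p)) + 1 / (1 - p) = (1 - t / d * p) / (1 - p)"
    by (simp add: diff_divide_distrib)
  also have "1 - t / d * p = (1 - p) / d"
    using d by (simp add: field_simps) (simp add: d_def)
  finally have "t / d * (- p / (1 - p)) + 1 / (1 - p) = 1 / d"
    using p by simp
  then show ?thesis
    unfolding f_fun_def q d_def[symmetric] using d by simp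
qed

lemma rank_one_nonzero:
  assumes "norm x = 1"
  shows "rank_one x \<noteq> 0"
proof
  assume "rank_one x = 0"
  then have "rank_one x x = 0" by simp
  then show False using assms by (simp add: rank_one_apply cinner_self)
qed

lemma f_fun_reciprocal:
  assumes "0 \<le> u" "k > 0"
  shows "f_fun (1 - k) (1 / (1 + u)) = 1 / (1 + k * u)"
proof -
  have "1 / (1 + u) * (1 - k) + (1 - (1 - k)) = (1 + k * u) / (1 + u)"
    using assms by (simp add: field_simps)
  then show ?thesis
    unfolding f_fun_def using assms by simp
qed

lemma reciprocal_parameter:
  fixes t :: real
  assumes "0 < t" "t \<le> 1"
  obtains u where "0 \<le> u" "t = 1 / (1 + u)"
proof
  show "0 \<le> 1 / t - 1" "t = 1 / (1 + (1 / t - 1))" using assms by simp_all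
qed

text \<open>
  Conjugation by a linear (\<open>\<kappa>\<close> the identity) or conjugate-linear isometry: in either case the
  conjugate is a linear operator, since \<open>\<kappa>\<close> occurs twice.
\<close>

lemma conjugation_effect:
  fixes U V A :: "'a::complex_hilbert_space \<Rightarrow>\<^sub>L 'a" and \<kappa> :: "complex \<Rightarrow> complex"
  assumes UV: "\<And>x. U (V x) = x" and VU: "\<And>x. V (U x) = x"
    and \<kappa>: "\<kappa> = (\<lambda>c. c) \<or> \<kappa> = cnj"
    and hom: "\<And>c x. U (c *\<^sub>C x) = \<kappa> c *\<^sub>C U x"
    and cinner: "\<And>x y. cinner (U x) (U y) = \<kappa> (cinner x y)"
    and A: "A \<in> effects"
  shows "inner ((U o\<^sub>L A o\<^sub>L V) z) z = inner (A (V z)) (V z)" and "U o\<^sub>L A o\<^sub>L V \<in> effects"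
proof -
  have \<kappa>\<kappa>: "\<kappa> (\<kappa> c) = c" and \<kappa>_Re: "Re (\<kappa> c) = Re c" for c
    using \<kappa> by auto
  have homV: "V (c *\<^sub>C x) = \<kappa> c *\<^sub>C V x" for c x
  proof -
    have "U (\<kappa> c *\<^sub>C V x) = c *\<^sub>C x" by (simp add: hom \<kappa>\<kappa> UV)
    then show ?thesis by (metis VU)
  qed
  have cinnerV: "cinner (U x) y = \<kappa> (cinner x (V y))" "cinner y (U x) = \<kappa> (cinner (V y) x)" for x y
    using cinner[of x "V y"] cinner[of "V y" x] by (simp_all add: UV)
  have inner: "inner (U x) y = inner x (V y)" for x y
    by (simp add: inner_eq_Re_cinner cinnerV \<kappa>_Re)
  show form: "inner ((U o\<^sub>L A o\<^sub>L V) z) z = inner (A (V z)) (V z)" for z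
    by (simp add: inner)
  have norm: "norm (V z) = norm z" for z
    using inner[of "V z" z] by (simp add: UV norm_eq_sqrt_inner)
  have sA: "selfadj_op A" by (simp add: A effects_selfadj)
  have "selfadj_op (U o\<^sub>L A o\<^sub>L V)"
    by (simp add: selfadj_op_def clinear_op_def homV hom \<kappa>\<kappa> cinnerV
        clinear_opD[OF selfadj_op_clinear[OF sA]] selfadj_op_cinner[OF sA])
  then show "U o\<^sub>L A o\<^sub>L V \<in> effects"
    unfolding effects_iff form using effects_nonneg[OF A] effects_le_norm[OF A, of "V _"] norm by auto
qed

locale effect_automorphism =
  fixes \<phi> :: "('a::complex_hilbert_space \<Rightarrow>\<^sub>L 'a) \<Rightarrow> ('a \<Rightarrow>\<^sub>L 'a)"
  assumes dim: "\<exists>S :: 'a set. cspace.independent S \<and> card S = 2"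
    and bij: "bij_betw \<phi> effects effects"
    and order: "A \<in> effects \<Longrightarrow> B \<in> effects \<Longrightarrow> A \<preceq> B \<longleftrightarrow> \<phi> A \<preceq> \<phi> B"
    and zero_product: "A \<in> effects \<Longrightarrow> B \<in> effects \<Longrightarrow> A o\<^sub>L B = 0 \<longleftrightarrow> \<phi> A o\<^sub>L \<phi> B = 0"
begin

lemma ex_unit: "\<exists>e :: 'a. norm e = 1"
proof -
  obtain S :: "'a set" where S: "cspace.independent S" "card S = 2" using dim by blast
  then have "S \<noteq> {}" by auto
  then obtain v where "v \<in> S" by blast
  then have "v \<noteq> 0" using S(1) cspace.dependent_zero by metis
  then have "norm ((1 / norm v) *\<^sub>R v) = 1" by simp
  then show ?thesis by blast
qed

lemma ex_orthogonal_unit: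
  assumes x: "norm (x :: 'a) = 1"
  shows "\<exists>x'. norm x' = 1 \<and> cinner x x' = 0"
proof (rule ccontr)
  assume no: "\<not> ?thesis"
  obtain S :: "'a set" where S: "cspace.independent S" "card S = 2" using dim by blast
  have "y \<in> cspace.span {x}" for y
  proof -
    define z where "z = y - cinner y x *\<^sub>C x"
    have "cinner x z = 0"
      using cinner_residual(1)[OF x, of y] cinner_eq_0_commute by (metis z_def)
    have "z = 0"
    proof (rule ccontr)
      assume "z \<noteq> 0"
      then have "norm ((1 / norm z) *\<^sub>R z) = 1" by simp
      moreover have "cinner x ((1 / norm z) *\<^sub>R z) = 0"
        by (simp add: \<open>cinner x z = 0\<close>)
      ultimately show False using no by blast
    qed
    then have "y = cinner y x *\<^sub>C x" by (simp add: z_def)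
    then show ?thesis using cspace.span_base cspace.span_scale by (metis singletonI)
  qed
  then have "S \<subseteq> cspace.span {x}" by blast
  then have "card S \<le> card {x}"
    using cspace.independent_span_bound[OF _ S(1)] by blast
  then show False using S(2) by simp
qed

lemma effect_image: "A \<in> effects \<Longrightarrow> \<phi> A \<in> effects"
  using bij bij_betwE by blast

lemma image_eq_iff: "A \<in> effects \<Longrightarrow> B \<in> effects \<Longrightarrow> \<phi> A = \<phi> B \<longleftrightarrow> A = B"
  using bij by (meson bij_betw_inv_into_left bij_betw_imp_inj_on inj_on_eq_iff)

lemma preimage:
  assumes "B \<in> effects"
  obtains A where "A \<in> effects" "\<phi> A = B"
  using bij assms by (metis bij_betw_imp_surj_on imageE)

lemma image_zero: "\<phi> 0 = 0"
proof -
  obtain B where B: "B \<in> effects" "\<phi> B = 0" using preimage[OF zero_in_effects] .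
  have zero_le: "0 \<preceq> A" if "A \<in> effects" for A
    using that by (simp add: effects_le_iff effects_nonneg)
  have "\<phi> 0 \<preceq> 0" using order[OF zero_in_effects B(1)] zero_le[OF B(1)] B(2) by simp
  then show ?thesis
    using effects_antisym zero_le effect_image by (metis zero_in_effects)
qed

lemma chain_effect_image_iff:
  assumes A: "A \<in> effects"
  shows "chain_effect (\<phi> A) \<longleftrightarrow> chain_effect A"
proof
  assume "chain_effect (\<phi> A)"
  then show "chain_effect A"
    using A order effect_image unfolding chain_effect_def by metis
next
  assume chain: "chain_effect A"
  show "chain_effect (\<phi> A)"
    unfolding chain_effect_def
  proof (intro conjI ballI impI)
    fix B C :: "'a \<Rightarrow>\<^sub>L 'a"
    assume BC: "B \<in> effects" "C \<in> effects" "B \<preceq> \<phi> A" "C \<preceq> \<phi> A"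
    obtain B' where B': "B' \<in> effects" "\<phi> B' = B" using preimage[OF BC(1)] .
    obtain C' where C': "C' \<in> effects" "\<phi> C' = C" using preimage[OF BC(2)] .
    have "B' \<preceq> C' \<or> C' \<preceq> B'"
      using chain BC(3,4) B' C' order[OF _ A] unfolding chain_effect_def by metis
    then show "B \<preceq> C \<or> C \<preceq> B"
      using order B' C' by metis
  qed (rule effect_image[OF A])
qed

lemma preimage_scaled_rank_one:
  assumes y: "norm y = 1" "0 \<le> s" "s \<le> 1"
  obtains x t where "norm x = 1" "0 \<le> t" "t \<le> 1" "\<phi> (t *\<^sub>R rank_one x) = s *\<^sub>R rank_one y"
proof -
  obtain B where B: "B \<in> effects" "\<phi> B = s *\<^sub>R rank_one y"
    using preimage[OF scaled_rank_one_effect[OF y]] .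
  then have "chain_effect B"
    using chain_effect_image_iff chain_effect_scaled_rank_one[OF y] by metis
  then show thesis
    using chain_effectE[of B] ex_unit B(2) that by metis
qed

text \<open>Rank one projections are the maximal elements among the effects with a chain below them.\<close>

lemma image_rank_one:
  assumes x: "norm x = 1"
  shows "\<exists>y. norm y = 1 \<and> \<phi> (rank_one x) = rank_one y"
proof -
  have "chain_effect (\<phi> (rank_one x))"
    using chain_effect_image_iff[OF rank_one_effect[OF x]] chain_effect_scaled_rank_one[OF x, of 1] by simp
  then obtain t y where y: "norm y = 1" "0 \<le> t" "t \<le> 1" "\<phi> (rank_one x) = t *\<^sub>R rank_one y"
    using chain_effectE[OF _ x] by blast
  obtain z s where z: "norm z = 1" "0 \<le> s" "s \<le> 1" "\<phi> (s *\<^sub>R rank_one z) = rank_one y"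
    using preimage_scaled_rank_one[OF y(1), of 1] by auto
  have "\<phi> (rank_one x) \<preceq> \<phi> (s *\<^sub>R rank_one z)"
    using rank_one_scale_le_iff[OF y(1), of t 1] y(3,4) z(4) by simp
  then have "1 *\<^sub>R rank_one x \<preceq> s *\<^sub>R rank_one z"
    using order[OF rank_one_effect[OF x] scaled_rank_one_effect[OF z(1-3)]] by simp
  note le = scaled_rank_one_le_rank_one[OF x z(1) _ this]
  then have "s *\<^sub>R rank_one z = rank_one x"
    using z(3) by (metis order_antisym scaleR_one zero_less_one)
  then show ?thesis using y(1) z(4) by auto
qed

definition ray :: "'a \<Rightarrow> 'a" where
  "ray x = (SOME y. norm y = 1 \<and> \<phi> (rank_one x) = rank_one y)"

lemma norm_ray: "norm x = 1 \<Longrightarrow> norm (ray x) = 1"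
  and image_rank_one_ray: "norm x = 1 \<Longrightarrow> \<phi> (rank_one x) = rank_one (ray x)"
  using someI_ex[OF image_rank_one] by (simp_all add: ray_def)

lemma image_scaled_rank_one:
  assumes x: "norm x = 1" and t: "0 \<le> t" "t \<le> 1"
  obtains s where "0 \<le> s" "s \<le> 1" "\<phi> (t *\<^sub>R rank_one x) = s *\<^sub>R rank_one (ray x)"
proof -
  have "t *\<^sub>R rank_one x \<preceq> rank_one x"
    using rank_one_scale_le_iff[OF x, of t 1] t by simp
  then have "\<phi> (t *\<^sub>R rank_one x) \<preceq> 1 *\<^sub>R rank_one (ray x)"
    using order[OF scaled_rank_one_effect[OF x t] rank_one_effect[OF x]]
    by (simp add: image_rank_one_ray x)
  then show thesis
    using below_scaled_rank_one[OF norm_ray[OF x] effect_image[OF scaled_rank_one_effect[OF x t]]] that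
    by metis
qed

lemma preimage_scaled_ray:
  assumes x: "norm x = 1" and s: "0 \<le> s" "s \<le> 1"
  obtains t where "0 \<le> t" "t \<le> 1" "\<phi> (t *\<^sub>R rank_one x) = s *\<^sub>R rank_one (ray x)"
proof -
  obtain B where B: "B \<in> effects" "\<phi> B = s *\<^sub>R rank_one (ray x)"
    using preimage[OF scaled_rank_one_effect[OF norm_ray[OF x] s]] .
  have "\<phi> B \<preceq> \<phi> (rank_one x)"
    using rank_one_scale_le_iff[OF norm_ray[OF x], of s 1] s B(2) by (simp add: image_rank_one_ray x)
  then have "B \<preceq> 1 *\<^sub>R rank_one x"
    using order[OF B(1) rank_one_effect[OF x]] by simp
  then show thesis
    using below_scaled_rank_one[OF x B(1)] that B(2) by metis
qed

lemma ray_surj: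
  assumes y: "norm y = 1"
  shows "\<exists>x c. norm x = 1 \<and> cmod c = 1 \<and> y = c *\<^sub>C ray x"
proof -
  obtain x t where x: "norm x = 1" "0 \<le> t" "t \<le> 1" "\<phi> (t *\<^sub>R rank_one x) = 1 *\<^sub>R rank_one y"
    using preimage_scaled_rank_one[OF y, of 1] by auto
  obtain s where "\<phi> (t *\<^sub>R rank_one x) = s *\<^sub>R rank_one (ray x)"
    using image_scaled_rank_one[OF x(1-3)] by metis
  then have "1 *\<^sub>R rank_one y \<preceq> s *\<^sub>R rank_one (ray x)"
    using x(4) effects_le_refl[OF rank_one_effect[OF y]] by simp
  then show ?thesis
    using scaled_rank_one_le_rank_one(1,2)[OF y norm_ray[OF x(1)] zero_less_one] x(1) by blast
qed

text \<open>
  The action on the multiples of \<open>rank_one x\<close>, in the coordinate \<open>u = 1 / t - 1\<close> in which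
  \<open>f\<^sub>p\<close> is multiplication by \<open>1 - p\<close>.
\<close>

lemma ex_ray_scale:
  assumes x: "norm x = 1" and u: "0 \<le> u"
  shows "\<exists>v\<ge>0. \<phi> ((1 / (1 + u)) *\<^sub>R rank_one x) = (1 / (1 + v)) *\<^sub>R rank_one (ray x)"
proof -
  have t: "0 \<le> 1 / (1 + u)" "1 / (1 + u) \<le> 1" using u by simp_all
  obtain s where s: "0 \<le> s" "s \<le> 1" "\<phi> ((1 / (1 + u)) *\<^sub>R rank_one x) = s *\<^sub>R rank_one (ray x)"
    using image_scaled_rank_one[OF x t] .
  have "s \<noteq> 0"
  proof
    assume "s = 0"
    then have "(1 / (1 + u)) *\<^sub>R rank_one x = 0"
      using s(3) image_zero image_eq_iff[OF scaled_rank_one_effect[OF x t] zero_in_effects] by simp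
    then show False
      using rank_one_nonzero[OF x] u by simp
  qed
  then show ?thesis
    using reciprocal_parameter[of s] s by (metis less_le)
qed

definition ray_scale :: "'a \<Rightarrow> real \<Rightarrow> real" where
  "ray_scale x u = (SOME v. 0 \<le> v \<and> \<phi> ((1 / (1 + u)) *\<^sub>R rank_one x) = (1 / (1 + v)) *\<^sub>R rank_one (ray x))"

lemma ray_scale_nonneg: "norm x = 1 \<Longrightarrow> 0 \<le> u \<Longrightarrow> 0 \<le> ray_scale x u"
  and image_ray_scale: "norm x = 1 \<Longrightarrow> 0 \<le> u \<Longrightarrow>
    \<phi> ((1 / (1 + u)) *\<^sub>R rank_one x) = (1 / (1 + ray_scale x u)) *\<^sub>R rank_one (ray x)"
  using someI_ex[OF ex_ray_scale] unfolding ray_scale_def by blast+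

lemma ray_scale_le_iff:
  assumes x: "norm x = 1" and "0 \<le> u" "0 \<le> v"
  shows "ray_scale x u \<le> ray_scale x v \<longleftrightarrow> u \<le> v"
proof -
  have "u \<le> v \<longleftrightarrow> (1 / (1 + v)) *\<^sub>R rank_one x \<preceq> (1 / (1 + u)) *\<^sub>R rank_one x"
    using assms by (simp add: rank_one_scale_le_iff field_simps)
  also have "\<dots> \<longleftrightarrow> \<phi> ((1 / (1 + v)) *\<^sub>R rank_one x) \<preceq> \<phi> ((1 / (1 + u)) *\<^sub>R rank_one x)"
    using assms by (intro order scaled_rank_one_effect) auto
  also have "\<dots> \<longleftrightarrow> ray_scale x u \<le> ray_scale x v"
    using assms ray_scale_nonneg[OF x, of u] ray_scale_nonneg[OF x, of v]
    by (simp add: image_ray_scale rank_one_scale_le_iff norm_ray field_simps)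
  finally show ?thesis by simp
qed

lemma ray_scale_surj:
  assumes x: "norm x = 1" and v: "0 \<le> v"
  obtains u where "0 \<le> u" "ray_scale x u = v"
proof -
  have "0 \<le> 1 / (1 + v)" "1 / (1 + v) \<le> 1" using v by simp_all
  then obtain t where t: "0 \<le> t" "t \<le> 1" "\<phi> (t *\<^sub>R rank_one x) = (1 / (1 + v)) *\<^sub>R rank_one (ray x)"
    using preimage_scaled_ray[OF x] by blast
  have "t \<noteq> 0"
  proof
    assume "t = 0"
    then have "(1 / (1 + v)) *\<^sub>R rank_one (ray x) = 0" using t(3) image_zero by simp
    then show False
      using rank_one_nonzero[OF norm_ray[OF x]] v by simp
  qed
  then obtain u where u: "0 \<le> u" "t = 1 / (1 + u)"
    using reciprocal_parameter[of t] t by (metis less_le)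
  then have "(1 / (1 + ray_scale x u)) *\<^sub>R rank_one (ray x) = (1 / (1 + v)) *\<^sub>R rank_one (ray x)"
    using t(3) image_ray_scale[OF x u(1)] by simp
  then have "1 / (1 + ray_scale x u) = 1 / (1 + v)"
    using rank_one_scale_le_iff[OF norm_ray[OF x]] by (metis order_antisym order_refl)
  then have "ray_scale x u = v"
    using ray_scale_nonneg[OF x u(1)] v by (simp add: frac_eq_eq)
  then show thesis using that u(1) by blast
qed

lemma ray_scale_zero: "norm x = 1 \<Longrightarrow> ray_scale x 0 = 0"
  by (metis order_antisym order_refl ray_scale_le_iff ray_scale_nonneg ray_scale_surj)

lemma ray_scale_pos: "norm x = 1 \<Longrightarrow> 0 < u \<Longrightarrow> 0 < ray_scale x u"
  by (metis less_le_not_le ray_scale_le_iff ray_scale_zero order_refl linorder_not_le)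

text \<open>Zero products enter here: \<open>1 - P\<close> is the largest effect whose product with \<open>P\<close> is \<open>0\<close>.\<close>

lemma image_compl_rank_one:
  assumes x: "norm x = 1"
  shows "\<phi> (id_blinfun - rank_one x) = id_blinfun - rank_one (ray x)"
proof -
  note rx = norm_ray[OF x] and P = rank_one_effect[OF x]
  note Q = compl_in_effects[OF rank_one_effect[OF x]] and Q' = compl_in_effects[OF rank_one_effect[OF rx]]
  have "(id_blinfun - rank_one x) o\<^sub>L rank_one x = 0"
    using zero_product_rank_one_iff[OF Q x] effects_le_refl[OF Q] by blast
  then have "\<phi> (id_blinfun - rank_one x) \<preceq> id_blinfun - rank_one (ray x)"
    using zero_product[OF Q P] zero_product_rank_one_iff[OF effect_image[OF Q] rx]
    by (simp add: image_rank_one_ray[OF x])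
  moreover obtain B where B: "B \<in> effects" "\<phi> B = id_blinfun - rank_one (ray x)"
    using preimage[OF Q'] .
  have "\<phi> B o\<^sub>L \<phi> (rank_one x) = 0"
    unfolding B(2) image_rank_one_ray[OF x]
    using zero_product_rank_one_iff[OF Q' rx] effects_le_refl[OF Q'] by blast
  then have "B \<preceq> id_blinfun - rank_one x"
    using zero_product[OF B(1) P] zero_product_rank_one_iff[OF B(1) x] by blast
  then have "id_blinfun - rank_one (ray x) \<preceq> \<phi> (id_blinfun - rank_one x)"
    using order[OF B(1) Q] B(2) by simp
  ultimately show ?thesis
    using effects_antisym effect_image[OF Q] Q' by blast
qed

text \<open>
  The effects above \<open>1 - P\<close> are the \<open>1 - s P\<close>. Which of them is the image is read off from the
  multiples of \<open>P\<close> below it, so the complement carries no further function of \<open>u\<close>.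
\<close>

lemma image_compl_scaled_rank_one:
  assumes x: "norm x = 1" and u: "0 \<le> u"
  shows "\<phi> (id_blinfun - (u / (1 + u)) *\<^sub>R rank_one x)
    = id_blinfun - (ray_scale x u / (1 + ray_scale x u)) *\<^sub>R rank_one (ray x)"
proof -
  note rx = norm_ray[OF x]
  define A where "A = id_blinfun - (u / (1 + u)) *\<^sub>R rank_one x"
  have s: "0 \<le> u / (1 + u)" "u / (1 + u) < 1" using u by simp_all
  note sP = scaled_rank_one_effect[OF x s(1) less_imp_le[OF s(2)]]
  have A: "A \<in> effects" unfolding A_def by (rule compl_in_effects[OF sP])
  note P = rank_one_effect[OF x] and P' = rank_one_effect[OF rx]
  have "id_blinfun - rank_one x \<preceq> A"
    using op_le_compl[of "rank_one x"] rank_one_scale_le_iff[OF x, of _ 1] s by (simp add: A_def)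
  then have "id_blinfun - rank_one (ray x) \<preceq> id_blinfun - (id_blinfun - \<phi> A)"
    using order[OF compl_in_effects[OF P] A] by (simp add: image_compl_rank_one x)
  then have "id_blinfun - \<phi> A \<preceq> 1 *\<^sub>R rank_one (ray x)"
    by (simp only: op_le_compl scaleR_one)
  then obtain r where r: "0 \<le> r" "r \<le> 1" "id_blinfun - \<phi> A = r *\<^sub>R rank_one (ray x)"
    using below_scaled_rank_one[OF rx compl_in_effects[OF effect_image[OF A]]] by metis
  then have \<phi>A: "\<phi> A = id_blinfun - r *\<^sub>R rank_one (ray x)" by (simp add: algebra_simps)
  have "r \<noteq> 1"
  proof
    assume "r = 1"
    then have "\<phi> A = \<phi> (id_blinfun - rank_one x)" by (simp add: \<phi>A image_compl_rank_one x)
    then have "(u / (1 + u)) *\<^sub>R rank_one x = 1 *\<^sub>R rank_one x"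
      using image_eq_iff[OF A compl_in_effects[OF P]] by (simp add: A_def)
    then show False
      using rank_one_scale_le_iff[OF x, of 1 "u / (1 + u)"] effects_le_refl[OF P] s by simp
  qed
  define w where "w = r / (1 - r)"
  have w: "0 \<le> w" "r = w / (1 + w)"
    using r(1,2) \<open>r \<noteq> 1\<close> by (simp_all add: w_def field_simps)
  have iff: "u \<le> v \<longleftrightarrow> w \<le> ray_scale x v" if v: "0 \<le> v" for v
  proof -
    have "u \<le> v \<longleftrightarrow> (1 / (1 + v)) *\<^sub>R rank_one x \<preceq> A"
      using scaled_rank_one_le_compl_iff[OF x x u v] x by (simp add: A_def cinner_self)
    also have "\<dots> \<longleftrightarrow> \<phi> ((1 / (1 + v)) *\<^sub>R rank_one x) \<preceq> \<phi> A"
      using v by (intro order A scaled_rank_one_effect[OF x]) auto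
    also have "\<dots> \<longleftrightarrow> w \<le> ray_scale x v"
      using scaled_rank_one_le_compl_iff[OF rx rx w(1) ray_scale_nonneg[OF x v]] rx
      by (simp add: image_ray_scale[OF x v] \<phi>A w(2) cinner_self)
    finally show ?thesis .
  qed
  obtain v where "0 \<le> v" "ray_scale x v = w" using ray_scale_surj[OF x w(1)] .
  then have "ray_scale x u = w"
    using iff[of u] iff[of v] u ray_scale_le_iff[OF x u] by (metis order_antisym order_refl)
  then show ?thesis
    using \<phi>A w(2) by (simp add: A_def)
qed

text \<open>
  Both sides of \<open>scaled_rank_one_le_compl_iff\<close> are available for \<open>x, y\<close> and for their images, so
  \<open>c u \<le> v\<close> is equivalent to \<open>c' F\<^sub>x u \<le> F\<^sub>y v\<close> for all \<open>v \<ge> 0\<close>. As \<open>F\<^sub>y\<close> is an increasing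
  bijection of \<open>[0, \<infinity>)\<close>, this is an equation.
\<close>

lemma ray_scale_transition:
  assumes x: "norm x = 1" and y: "norm y = 1" and u: "0 \<le> u"
  shows "ray_scale y (transition x y * u) = transition (ray x) (ray y) * ray_scale x u"
proof -
  have iff: "transition x y * u \<le> v \<longleftrightarrow> transition (ray x) (ray y) * ray_scale x u \<le> ray_scale y v"
    if v: "0 \<le> v" for v
  proof -
    have A: "id_blinfun - (u / (1 + u)) *\<^sub>R rank_one x \<in> effects"
      using u by (intro compl_in_effects scaled_rank_one_effect[OF x]) auto
    have "transition x y * u \<le> v
        \<longleftrightarrow> (1 / (1 + v)) *\<^sub>R rank_one y \<preceq> id_blinfun - (u / (1 + u)) *\<^sub>R rank_one x"
      using scaled_rank_one_le_compl_iff[OF x y u v] by (simp add: transition_def)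
    also have "\<dots> \<longleftrightarrow> \<phi> ((1 / (1 + v)) *\<^sub>R rank_one y) \<preceq> \<phi> (id_blinfun - (u / (1 + u)) *\<^sub>R rank_one x)"
      using v by (intro order A scaled_rank_one_effect[OF y]) auto
    also have "\<dots> \<longleftrightarrow> transition (ray x) (ray y) * ray_scale x u \<le> ray_scale y v"
      unfolding image_ray_scale[OF y v] image_compl_scaled_rank_one[OF x u]
      using scaled_rank_one_le_compl_iff[OF norm_ray[OF x] norm_ray[OF y]
          ray_scale_nonneg[OF x u] ray_scale_nonneg[OF y v]]
      by (simp add: transition_def)
    finally show ?thesis .
  qed
  have nonneg: "0 \<le> transition x y * u" using u by simp
  obtain v where v: "0 \<le> v" "ray_scale y v = transition (ray x) (ray y) * ray_scale x u"
    using ray_scale_surj[OF y] ray_scale_nonneg[OF x u] by (metis mult_nonneg_nonneg transition_nonneg)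
  have "ray_scale y (transition x y * u) \<le> ray_scale y v"
    using iff[OF v(1)] v(2) ray_scale_le_iff[OF y nonneg v(1)] by simp
  then show ?thesis
    using iff[OF nonneg] v(2) by simp
qed

text \<open>
  The rank one effects below \<open>\<phi> A\<close> and below \<open>U f\<^sub>p(A) U\<^sup>*\<close> are the same: both are the images of
  the rank one effects below \<open>A\<close>.
\<close>

lemma image_form:
  obtains U :: "'a \<Rightarrow>\<^sub>L 'a" and p where "unitary_op U \<or> antiunitary_op U" "p < 1"
    "\<And>A. A \<in> effects \<Longrightarrow> \<phi> A = U o\<^sub>L cfc (f_fun p) A o\<^sub>L adj_op U"
proof -
  obtain e :: 'a where e: "norm e = 1" using ex_unit by blast
  define k where "k = ray_scale e 1"
  define p where "p = 1 - k"
  have k: "k > 0" unfolding k_def by (rule ray_scale_pos[OF e zero_less_one])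
  then have p: "p < 1" by (simp add: p_def)
  have surj: "\<exists>x c. norm x = 1 \<and> y = c *\<^sub>C ray x" if "norm y = 1" for y
    using ray_surj[OF that] by blast
  have rigid: "norm x = 1 \<Longrightarrow> norm y = 1 \<Longrightarrow> transition (ray x) (ray y) = transition x y"
    "norm x = 1 \<Longrightarrow> 0 \<le> u \<Longrightarrow> ray_scale x u = k * u" for x y u
    unfolding k_def
    using transition_rigidity[of ray ray_scale e, OF ex_orthogonal_unit norm_ray surj ray_scale_zero ray_scale_pos
        _ ray_scale_transition e] ray_scale_le_iff by (smt (verit))+
  obtain U :: "'a \<Rightarrow>\<^sub>L 'a" and \<kappa> :: "complex \<Rightarrow> complex"
    where U: "unitary_op U \<or> antiunitary_op U"
      and rank_one_U: "\<And>x. norm x = 1 \<Longrightarrow> rank_one (U x) = rank_one (ray x)"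
      and inv: "\<And>x. U (adj_op U x) = x" "\<And>x. adj_op U (U x) = x"
      and \<kappa>: "\<kappa> = (\<lambda>c. c) \<or> \<kappa> = cnj" "\<And>c x. U (c *\<^sub>C x) = \<kappa> c *\<^sub>C U x"
        "\<And>x y. cinner (U x) (U y) = \<kappa> (cinner x y)"
  proof (rule Wigner[of ray e])
    show "norm (ray x) = 1" if "norm x = 1" for x by (rule norm_ray[OF that])
    show "cmod (cinner (ray x) (ray y)) = cmod (cinner x y)" if "norm x = 1" "norm y = 1" for x y
      using rigid(1)[OF that] by (simp add: transition_def power2_eq_iff_nonneg)
    show "\<exists>x c. norm x = 1 \<and> y = c *\<^sub>C ray x" if "norm y = 1" for y by (rule surj[OF that])
  qed (rule e, rule that)
  note conj = conjugation_effect[OF inv \<kappa>]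
  have image: "\<phi> (t *\<^sub>R rank_one x) = f_fun p t *\<^sub>R rank_one (U x)"
    if x: "norm x = 1" and t: "0 \<le> t" "t \<le> 1" for x t
  proof (cases "t = 0")
    case True
    then show ?thesis by (simp add: image_zero f_fun_def)
  next
    case False
    then obtain u where u: "0 \<le> u" "t = 1 / (1 + u)"
      using reciprocal_parameter[of t] t by (metis less_le)
    show ?thesis
      unfolding u(2) image_ray_scale[OF x u(1)] rank_one_U[OF x] rigid(2)[OF x u(1)] p_def
        f_fun_reciprocal[OF u(1) k] ..
  qed
  have "\<phi> A = U o\<^sub>L cfc (f_fun p) A o\<^sub>L adj_op U" if A: "A \<in> effects" for A
  proof -
    define T where "T = cfc (f_fun p) A"
    define B where "B = U o\<^sub>L T o\<^sub>L adj_op U"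
    have T_eq: "T o\<^sub>L f_denom p A = A" unfolding T_def by (rule cfc_f_fun_denom[OF A p])
    have T: "T \<in> effects" by (rule f_solution_effect[OF A p T_eq])
    have B: "B \<in> effects" unfolding B_def by (rule conj(2)[OF T])
    have q: "- p / (1 - p) < 1" using p by (simp add: field_simps)
    have T_iff: "f_fun p t *\<^sub>R rank_one x \<preceq> T \<longleftrightarrow> t *\<^sub>R rank_one x \<preceq> A"
      if x: "norm x = 1" and t: "0 \<le> t" "t \<le> 1" for x t
    proof
      assume "t *\<^sub>R rank_one x \<preceq> A"
      then show "f_fun p t *\<^sub>R rank_one x \<preceq> T"
        by (rule f_solution_rank_one_le[OF A p T_eq x t])
    next
      have den: "0 < t * p + (1 - p)" by (rule f_fun_denom_pos(2)[OF p t])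
      have "t \<le> t * p + (1 - p)"
        using mult_right_mono[of p 1 "1 - t"] p t by (simp add: algebra_simps)
      then have ft: "0 \<le> f_fun p t" "f_fun p t \<le> 1"
        using den t by (simp_all add: f_fun_def)
      assume "f_fun p t *\<^sub>R rank_one x \<preceq> T"
      from f_solution_rank_one_le[OF T q f_solution_inverse[OF A p T_eq] x ft this]
      show "t *\<^sub>R rank_one x \<preceq> A"
        by (simp only: f_fun_inverse[OF p t])
    qed
    have B_iff: "s *\<^sub>R rank_one (U x) \<preceq> B \<longleftrightarrow> s *\<^sub>R rank_one x \<preceq> T" for s x
    proof -
      have "s *\<^sub>R rank_one (U x) \<preceq> B
          \<longleftrightarrow> (\<forall>z. s * (cmod (cinner z (U x)))\<^sup>2 \<le> inner (T (adj_op U z)) (adj_op U z))"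
        unfolding scaled_rank_one_le_iff[OF effects_selfadj[OF B]] by (simp only: B_def conj(1)[OF T])
      also have "\<dots> \<longleftrightarrow> (\<forall>w. s * (cmod (cinner (U w) (U x)))\<^sup>2 \<le> inner (T w) w)"
        by (metis inv)
      also have "\<dots> \<longleftrightarrow> s *\<^sub>R rank_one x \<preceq> T"
        unfolding scaled_rank_one_le_iff[OF effects_selfadj[OF T]] \<kappa>(3) using \<kappa>(1) by auto
      finally show ?thesis .
    qed
    \<comment> \<open>Every rank one effect is \<open>\<phi> (t *\<^sub>R rank_one x)\<close> for some \<open>t\<close> and \<open>x\<close>.\<close>
    have "s *\<^sub>R rank_one y \<preceq> \<phi> A \<longleftrightarrow> s *\<^sub>R rank_one y \<preceq> B"
      if y: "norm y = 1" "0 \<le> s" "s \<le> 1" for y s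
    proof -
      obtain x t where x: "norm x = 1" and t: "0 \<le> t" "t \<le> 1"
        and eq: "\<phi> (t *\<^sub>R rank_one x) = s *\<^sub>R rank_one y"
        using preimage_scaled_rank_one[OF y] .
      have "s *\<^sub>R rank_one y \<preceq> \<phi> A \<longleftrightarrow> t *\<^sub>R rank_one x \<preceq> A"
        using order[OF scaled_rank_one_effect[OF x t] A] eq by simp
      also have "\<dots> \<longleftrightarrow> s *\<^sub>R rank_one y \<preceq> B"
        unfolding eq[symmetric] image[OF x t] B_iff T_iff[OF x t] ..
      finally show ?thesis .
    qed
    then have "\<phi> A = B"
      using effects_le_rank_one[OF effect_image[OF A] B] effects_le_rank_one[OF B effect_image[OF A]]
      by (intro effects_antisym[OF effect_image[OF A] B]) blast+
    then show ?thesis by (simp only: B_def T_def)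
  qed
  then show thesis using that U p by blast
qed

end

theorem theorem1:
  fixes \<phi> :: "('a::complex_hilbert_space \<Rightarrow>\<^sub>L 'a) \<Rightarrow> ('a \<Rightarrow>\<^sub>L 'a)"
  assumes dim: "\<exists>S :: 'a set. cspace.independent S \<and> card S = 2"
    and bij: "bij_betw \<phi> effects effects"
    and order: "\<And>A B. A \<in> effects \<Longrightarrow> B \<in> effects \<Longrightarrow> A \<preceq> B \<longleftrightarrow> \<phi> A \<preceq> \<phi> B"
    and zero_product: "\<And>A B. A \<in> effects \<Longrightarrow> B \<in> effects \<Longrightarrow>
      A o\<^sub>L B = 0 \<longleftrightarrow> \<phi> A o\<^sub>L \<phi> B = 0"
  shows "\<exists>(U :: 'a \<Rightarrow>\<^sub>L 'a) (p :: real). (unitary_op U \<or> antiunitary_op U) \<and> p < 1 \<and>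
    (\<forall>A\<in>effects. \<phi> A = U o\<^sub>L cfc (f_fun p) A o\<^sub>L adj_op U)"
proof -
  interpret effect_automorphism \<phi>
    by unfold_locales (fact dim bij order zero_product)+
  show ?thesis
    using image_form by metis
qed

end
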